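(* Let $\mu$ be a probability measure on $\mathbb N^d$ with downward closed support. Then the following statements are equivalent: 1. $\mu$ is ultra-log-concave (ULC). 2. For every $\mathbf x\in\mathrm{supp}(\mu)$ and $t\in[0,1)$, the tilted pinning $(1-t)*\mu^{\mathbf x}$ is $1$-spectrally independent. 3. For every $\mathbf x\in\mathrm{supp}(\mu)$ and $\boldsymbol\theta\in\mathbb R_{>0}^d$, the tilted pinning $\boldsymbol\theta*\mu^{\mathbf x}$ is $1$-spectrally independent. 4. The probability-generating function $g_\mu$ is strongly log-concave. 5. The probability-generating function $g_\mu$ is completely log-concave.
   Context: $\mathbb N=\{0,1,2,\dots\}$, $[d]=\{1,\dots,d\}$, $\mathbf e_i$ is the $i$-th standard basis vector, $\mathbf n!=\prod_i n_i!$, $\boldsymbol\theta^{\mathbf n}=\prod_i\theta_i^{n_i}$. A set $S\subseteq\mathbb N^d$ is downward closed if $\mathbf n\in S$ and $\mathbf 0\le\mathbf m\le\mathbf n$ (coordinatewise) imply $\mathbf m\in S$. ULC: $\mu$ with downward closed support is ULC if, with $a(\mathbf n)=\mathbf n!\,\mu(\mathbf n)$ and $\mathcal I_{\mathbf n}=\{i\in[d]:\mathbf n+\mathbf e_i\in\mathrm{supp}(\mu)\}$, the matrix $\big(1-\frac{a(\mathbf n)a(\mathbf n+\mathbf e_i+\mathbf e_j)}{a(\mathbf n+\mathbf e_i)a(\mathbf n+\mathbf e_j)}\big)_{i,j\in\mathcal I_{\mathbf n}}$ is positive semidefinite for every $\mathbf n\in\mathrm{supp}(\mu)$. Weighted pinning: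 for $\mathbf x\in\mathrm{supp}(\mu)$, $\mu^{\mathbf x}$ is the probability measure on $\mathbb N^d$ with $\mu^{\mathbf x}(\mathbf k)\propto\mu(\mathbf x+\mathbf k)\prod_{i=1}^d\binom{x_i+k_i}{x_i}$. Exponential tilt: for $\boldsymbol\theta\in\mathbb R_{>0}^d$, $(\boldsymbol\theta*\rho)(\mathbf n)=\boldsymbol\theta^{\mathbf n}\rho(\mathbf n)/\mathbf E_{\mathbf k\sim\rho}[\boldsymbol\theta^{\mathbf k}]$; for a scalar $\theta>0$, $\theta*\rho=(\theta\mathbf 1)*\rho$ with $\mathbf 1$ the all-ones vector. In statements 2 and 3, the assertion includes that the tilted pinning is well defined (finite normalizing constant) and has finite second moments. $\eta$-spectral independence: a probability measure $\rho$ on $\mathbb N^d$ is $\eta$-spectrally independent if $\mathrm{cov}(\rho)\preceq\eta\,\mathrm{diag}(\mathrm{mean}(\rho))$, where $\mathrm{mean}(\rho)$ and $\mathrm{cov}(\rho)$ are its mean vector and covariance matrix. Generating function: $g_\mu(\boldsymbol\theta)=\sum_{\mathbf n\in\mathbb N^d}\mu(\mathbf n)\boldsymbol\theta^{\mathbf n}$ (a formal power series). It is strongly log-concave if for every $\mathbf x\in\mathbb N^d$, $\partial_1^{x_1}\cdots\partial_d^{x_d}g_\mu$ is either identically zero or finite, positive, and log-concave on $\mathbb R_{>0}^d$. It is completely log-concave if for every $k\in\mathbb N$ and $\mathbf v_1,\dots,\mathbf v_k\in\mathbb R_{\ge0}^d$, $\partial_{\mathbf v_1}\cdots\partial_{\mathbf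 v_k}g_\mu$ is either identically zero or finite, positive, and log-concave on $\mathbb R_{>0}^d$, where $\partial_{\mathbf v}=\sum_{i=1}^d v_i\partial_i$. *)

theory Defs
  imports "HOL-Probability.Probability"
begin

text \<open>
  The dimension \<open>d\<close> is the cardinality of the finite index type \<open>'d\<close>. Points of \<open>\<nat>\<^sup>d\<close> are elements
  of \<open>nat ^ 'd\<close>, ordered coordinatewise, and a probability measure on the countable discrete space
  \<open>\<nat>\<^sup>d\<close> is a \<open>pmf\<close>.
\<close>

definition unit_vec :: "'d::finite \<Rightarrow> nat ^ 'd"
  where "unit_vec i = axis i 1"

definition mfact :: "nat ^ 'd::finite \<Rightarrow> real"
  where "mfact n = (\<Prod>i\<in>UNIV. fact (n $ i))"

definition mpower :: "real ^ 'd::finite \<Rightarrow> nat ^ 'd \<Rightarrow> real"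
  where "mpower \<theta> n = (\<Prod>i\<in>UNIV. (\<theta> $ i) ^ (n $ i))"

definition pos_orthant :: "(real ^ 'd::finite) set"
  where "pos_orthant = {\<theta>. \<forall>i. 0 < \<theta> $ i}"

definition downward_closed :: "(nat ^ 'd::finite) set \<Rightarrow> bool"
  where "downward_closed S \<longleftrightarrow> (\<forall>n\<in>S. \<forall>m. m \<le> n \<longrightarrow> m \<in> S)"

text \<open>Positive semidefiniteness of the real matrix \<open>(M i j)\<close> with \<open>i, j \<in> I\<close>.\<close>

definition psd_on :: "'d set \<Rightarrow> ('d \<Rightarrow> 'd \<Rightarrow> real) \<Rightarrow> bool"
  where "psd_on I M \<longleftrightarrow>
    (\<forall>i\<in>I. \<forall>j\<in>I. M i j = M j i) \<and>
    (\<forall>v. 0 \<le> (\<Sum>i\<in>I. \<Sum>j\<in>I. v i * M i j * v j))"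

definition loewner_le :: "('d::finite \<Rightarrow> 'd \<Rightarrow> real) \<Rightarrow> ('d \<Rightarrow> 'd \<Rightarrow> real) \<Rightarrow> bool"
  where "loewner_le A B \<longleftrightarrow> psd_on UNIV (\<lambda>i j. B i j - A i j)"


section \<open>Ultra-log-concavity\<close>

definition ulc_coeff :: "(nat ^ 'd::finite) pmf \<Rightarrow> nat ^ 'd \<Rightarrow> real"
  where "ulc_coeff \<mu> n = mfact n * pmf \<mu> n"

definition ulc_index :: "(nat ^ 'd::finite) pmf \<Rightarrow> nat ^ 'd \<Rightarrow> 'd set"
  where "ulc_index \<mu> n = {i. n + unit_vec i \<in> set_pmf \<mu>}"

definition ULC :: "(nat ^ 'd::finite) pmf \<Rightarrow> bool"
  where "ULC \<mu> \<longleftrightarrow> downward_closed (set_pmf \<mu>) \<and>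
    (\<forall>n\<in>set_pmf \<mu>. psd_on (ulc_index \<mu> n)
      (\<lambda>i j. 1 - ulc_coeff \<mu> n * ulc_coeff \<mu> (n + unit_vec i + unit_vec j)
               / (ulc_coeff \<mu> (n + unit_vec i) * ulc_coeff \<mu> (n + unit_vec j))))"


section \<open>Pinnings, tilts and spectral independence\<close>

text \<open>
  The normalizing constants of a pinning or of a tilt may be infinite, so each operation comes with
  a predicate saying that it is well defined; only then does \<^const>\<open>embed_pmf\<close> return the intended
  measure (lemmas \<open>pmf_pinning\<close> and \<open>pmf_tilt\<close>).
\<close>

definition pinning_weight :: "(nat ^ 'd::finite) pmf \<Rightarrow> nat ^ 'd \<Rightarrow> nat ^ 'd \<Rightarrow> real"
  where "pinning_weight \<mu> x k =
    pmf \<mu> (x + k) * (\<Prod>i\<in>UNIV. real ((x $ i + k $ i) choose (x $ i)))"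

definition pinning_defined :: "(nat ^ 'd::finite) pmf \<Rightarrow> nat ^ 'd \<Rightarrow> bool"
  where "pinning_defined \<mu> x \<longleftrightarrow> x \<in> set_pmf \<mu> \<and> pinning_weight \<mu> x summable_on UNIV"

definition pinning :: "(nat ^ 'd::finite) pmf \<Rightarrow> nat ^ 'd \<Rightarrow> (nat ^ 'd) pmf"
  where "pinning \<mu> x = embed_pmf (\<lambda>k. pinning_weight \<mu> x k / infsum (pinning_weight \<mu> x) UNIV)"

definition tilt_defined :: "real ^ 'd::finite \<Rightarrow> (nat ^ 'd) pmf \<Rightarrow> bool"
  where "tilt_defined \<theta> \<rho> \<longleftrightarrow> \<theta> \<in> pos_orthant \<and> integrable (measure_pmf \<rho>) (mpower \<theta>)"

definition tilt :: "real ^ 'd::finite \<Rightarrow> (nat ^ 'd) pmf \<Rightarrow> (nat ^ 'd) pmf"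
  where "tilt \<theta> \<rho> =
    embed_pmf (\<lambda>n. mpower \<theta> n * pmf \<rho> n / measure_pmf.expectation \<rho> (mpower \<theta>))"

definition finite_second_moments :: "(nat ^ 'd::finite) pmf \<Rightarrow> bool"
  where "finite_second_moments \<rho> \<longleftrightarrow> (\<forall>i. integrable (measure_pmf \<rho>) (\<lambda>n. (real (n $ i))\<^sup>2))"

definition mean :: "(nat ^ 'd::finite) pmf \<Rightarrow> 'd \<Rightarrow> real"
  where "mean \<rho> i = measure_pmf.expectation \<rho> (\<lambda>n. real (n $ i))"

definition cov :: "(nat ^ 'd::finite) pmf \<Rightarrow> 'd \<Rightarrow> 'd \<Rightarrow> real"
  where "cov \<rho> i j =
    measure_pmf.expectation \<rho> (\<lambda>n. (real (n $ i) - mean \<rho> i) * (real (n $ j) - mean \<rho> j))"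

definition spectrally_independent :: "real \<Rightarrow> (nat ^ 'd::finite) pmf \<Rightarrow> bool"
  where "spectrally_independent \<eta> \<rho> \<longleftrightarrow>
    loewner_le (cov \<rho>) (\<lambda>i j. \<eta> * (if i = j then mean \<rho> i else 0))"

definition tilted_pinning_spectrally_independent ::
    "real \<Rightarrow> real ^ 'd::finite \<Rightarrow> (nat ^ 'd) pmf \<Rightarrow> nat ^ 'd \<Rightarrow> bool"
  where "tilted_pinning_spectrally_independent \<eta> \<theta> \<mu> x \<longleftrightarrow>
    pinning_defined \<mu> x \<and> tilt_defined \<theta> (pinning \<mu> x) \<and>
    finite_second_moments (tilt \<theta> (pinning \<mu> x)) \<and>
    spectrally_independent \<eta> (tilt \<theta> (pinning \<mu> x))"


section \<open>Generating functions\<close>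

text \<open>A formal power series in the variables indexed by \<open>'d\<close> is its family of coefficients.\<close>

type_synonym 'd mfps = "nat ^ 'd \<Rightarrow> real"

definition gen_fun :: "(nat ^ 'd::finite) pmf \<Rightarrow> 'd mfps"
  where "gen_fun \<mu> = (\<lambda>n. pmf \<mu> n)"

definition partial :: "'d::finite \<Rightarrow> 'd mfps \<Rightarrow> 'd mfps"
  where "partial i f = (\<lambda>n. real (n $ i + 1) * f (n + unit_vec i))"

definition dir_partial :: "real ^ 'd::finite \<Rightarrow> 'd mfps \<Rightarrow> 'd mfps"
  where "dir_partial v f = (\<lambda>n. \<Sum>i\<in>UNIV. v $ i * partial i f n)"

text \<open>
  The composition over all \<open>i\<close> of the \<open>x $ i\<close>-fold iterates of \<^term>\<open>partial i\<close>; these operators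
  commute, so the order is immaterial (lemmas \<open>comp_fun_commute_partial\<close> and \<open>mixed_partial_eq\<close>).
\<close>

definition mixed_partial :: "nat ^ 'd::finite \<Rightarrow> 'd mfps \<Rightarrow> 'd mfps"
  where "mixed_partial x f = Finite_Set.fold (\<lambda>i. partial i ^^ (x $ i)) f UNIV"

definition converges_at :: "'d::finite mfps \<Rightarrow> real ^ 'd \<Rightarrow> bool"
  where "converges_at f \<theta> \<longleftrightarrow> (\<lambda>n. f n * mpower \<theta> n) summable_on UNIV"

definition mfps_value :: "'d::finite mfps \<Rightarrow> real ^ 'd \<Rightarrow> real"
  where "mfps_value f \<theta> = (\<Sum>\<^sub>\<infinity>n. f n * mpower \<theta> n)"

definition log_concave_on :: "'a::real_vector set \<Rightarrow> ('a \<Rightarrow> real) \<Rightarrow> bool"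
  where "log_concave_on S F \<longleftrightarrow> (\<forall>x\<in>S. 0 < F x) \<and> concave_on S (\<lambda>x. ln (F x))"

definition zero_or_log_concave :: "'d::finite mfps \<Rightarrow> bool"
  where "zero_or_log_concave f \<longleftrightarrow>
    f = (\<lambda>_. 0) \<or>
    (\<forall>\<theta>\<in>pos_orthant. converges_at f \<theta>) \<and> log_concave_on pos_orthant (mfps_value f)"

definition strongly_log_concave :: "'d::finite mfps \<Rightarrow> bool"
  where "strongly_log_concave f \<longleftrightarrow> (\<forall>x. zero_or_log_concave (mixed_partial x f))"

definition completely_log_concave :: "'d::finite mfps \<Rightarrow> bool"
  where "completely_log_concave f \<longleftrightarrow>
    (\<forall>vs. (\<forall>v\<in>set vs. \<forall>i. 0 \<le> v $ i) \<longrightarrow> zero_or_log_concave (foldr dir_partial vs f))"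


section \<open>Explicit forms of pinnings, tilts and mixed partials\<close>

lemma pmf_embed_normalized:
  fixes w :: "'a \<Rightarrow> real"
  assumes nonneg: "\<And>k. 0 \<le> w k" and summ: "w summable_on UNIV" and pos: "0 < w a"
  shows "pmf (embed_pmf (\<lambda>k. w k / infsum w UNIV)) k = w k / infsum w UNIV"
proof -
  have "sum w {a} \<le> infsum w UNIV"
    by (rule finite_sum_le_infsum) (use summ nonneg in auto)
  then have Z: "0 < infsum w UNIV" using pos by simp
  have "((\<lambda>k. w k / infsum w UNIV) has_sum (infsum w UNIV / infsum w UNIV)) UNIV"
    using has_sum_cmult_left[OF has_sum_infsum[OF summ], of "inverse (infsum w UNIV)"]
    by (simp add: field_simps)
  then have hs: "((\<lambda>k. w k / infsum w UNIV) has_sum 1) UNIV" using Z by simp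
  have int: "integrable (count_space UNIV) (\<lambda>k. w k / infsum w UNIV)"
    using has_sum_imp_summable[OF hs] summable_on_iff_abs_summable_on_real
    by (metis abs_summable_equivalent abs_summable_on_def)
  have "(\<integral>\<^sup>+ k. ennreal (w k / infsum w UNIV) \<partial>count_space UNIV)
      = ennreal (\<integral>k. w k / infsum w UNIV \<partial>count_space UNIV)"
    using int Z nonneg by (intro nn_integral_eq_integral) auto
  also have "(\<integral>k. w k / infsum w UNIV \<partial>count_space UNIV) = infsetsum (\<lambda>k. w k / infsum w UNIV) UNIV"
    by (simp add: infsetsum_def)
  also have "\<dots> = 1"
    using infsetsum_infsum[of "\<lambda>k. w k / infsum w UNIV" UNIV] int infsumI[OF hs]
    by (simp add: abs_summable_on_def)
  finally show ?thesis
    using Z nonneg by (intro pmf_embed_pmf) auto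
qed

lemma pmf_pinning:
  assumes "pinning_defined \<mu> x"
  shows "pmf (pinning \<mu> x) k = pinning_weight \<mu> x k / infsum (pinning_weight \<mu> x) UNIV"
  unfolding pinning_def
proof (rule pmf_embed_normalized)
  show "0 < pinning_weight \<mu> x 0"
    using assms by (auto simp: pinning_defined_def pinning_weight_def pmf_positive)
  show "0 \<le> pinning_weight \<mu> x k" for k
    by (auto simp: pinning_weight_def intro!: mult_nonneg_nonneg prod_nonneg)
qed (use assms in \<open>simp add: pinning_defined_def\<close>)

lemma pmf_tilt:
  assumes "tilt_defined \<theta> \<rho>"
  shows "pmf (tilt \<theta> \<rho>) n = mpower \<theta> n * pmf \<rho> n / measure_pmf.expectation \<rho> (mpower \<theta>)"
proof -
  let ?w = "\<lambda>n. mpower \<theta> n * pmf \<rho> n"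
  have pos: "0 < mpower \<theta> k" for k
    using assms by (auto simp: tilt_defined_def pos_orthant_def mpower_def intro!: prod_pos)
  have "integrable (density (count_space UNIV) (\<lambda>k. ennreal (pmf \<rho> k))) (mpower \<theta>)"
    using assms by (simp add: tilt_defined_def measure_pmf_eq_density)
  then have int: "integrable (count_space UNIV) ?w"
    by (subst (asm) integrable_density) (auto simp: mult.commute)
  then have summ: "?w summable_on UNIV"
    using abs_summable_equivalent[of ?w UNIV] abs_summable_summable[of ?w UNIV]
    by (simp add: abs_summable_on_def)
  have "measure_pmf.expectation \<rho> (mpower \<theta>) = (\<integral>n. ?w n \<partial>count_space UNIV)"
    by (subst measure_pmf_eq_density, subst integral_density) (auto simp: mult.commute)
  also have "\<dots> = infsum ?w UNIV"
    using int infsetsum_infsum[of ?w UNIV] by (simp add: abs_summable_on_def infsetsum_def)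
  finally have E: "measure_pmf.expectation \<rho> (mpower \<theta>) = infsum ?w UNIV" .
  obtain a where "a \<in> set_pmf \<rho>" using set_pmf_not_empty[of \<rho>] by blast
  then have "0 < ?w a" using pos by (simp add: pmf_positive)
  then show ?thesis
    unfolding tilt_def E using pos summ
    by (intro pmf_embed_normalized) (auto simp: less_imp_le)
qed

lemma partial_commute: "partial i (partial j f) = partial j (partial i f)"
  by (cases "i = j") (auto simp: partial_def fun_eq_iff unit_vec_def axis_def add_ac)

lemma partial_funpow:
  "(partial i ^^ m) f =
    (\<lambda>n. fact (n $ i + m) / fact (n $ i) * f (n + (\<chi> j. if j = i then m else 0)))"
proof (induction m)
  case 0
  have "(\<chi> j. if j = i then 0 else 0) = (0 :: nat ^ 'a)" by (simp add: vec_eq_iff)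
  then show ?case by simp
next
  case (Suc m)
  have "n + unit_vec i + (\<chi> j. if j = i then m else 0) = n + (\<chi> j. if j = i then Suc m else 0)" for n
    by (simp add: vec_eq_iff unit_vec_def axis_def)
  moreover have "(1 + real k) * (fact (Suc k + m) / fact (Suc k)) = (fact (k + Suc m) / fact k :: real)"
    for k
    by (simp add: divide_simps)
  ultimately show ?case
    unfolding funpow.simps o_apply Suc
    by (simp add: partial_def fun_eq_iff unit_vec_def axis_def add_ac flip: mult.assoc)
qed

lemma comp_fun_commute_partial: "comp_fun_commute (\<lambda>i :: 'a::finite. partial i ^^ m i)"
proof
  fix i j :: 'a
  have 1: "partial i ((partial j ^^ q) f) = (partial j ^^ q) (partial i f)" for q f
    by (induction q) (simp_all add: partial_commute[of i j])
  have "(partial i ^^ p) ((partial j ^^ q) f) = (partial j ^^ q) ((partial i ^^ p) f)" for p q f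
    by (induction p) (simp_all add: 1)
  then show "(partial j ^^ m j) \<circ> (partial i ^^ m i) = (partial i ^^ m i) \<circ> (partial j ^^ m j)"
    by (simp add: fun_eq_iff)
qed

lemma mixed_partial_eq:
  "mixed_partial x f = (\<lambda>n. mfact (n + x) / mfact n * f (n + x))"
proof -
  interpret comp_fun_commute "\<lambda>i. partial i ^^ (x $ i)" by (rule comp_fun_commute_partial)
  have "Finite_Set.fold (\<lambda>i. partial i ^^ (x $ i)) f S =
    (\<lambda>n. (\<Prod>i\<in>S. fact (n $ i + x $ i) / fact (n $ i)) * f (n + (\<chi> j. if j \<in> S then x $ j else 0)))"
    for S :: "'a set"
  proof (induction S rule: finite_induct[OF finite])
    case 1
    have "(\<chi> j. if j \<in> {} then x $ j else 0) = (0 :: nat ^ 'a)" by (simp add: vec_eq_iff)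
    then show ?case by simp
  next
    case (2 i S)
    have "n + (\<chi> j. if j = i then x $ i else 0) + (\<chi> j. if j \<in> S then x $ j else 0)
        = n + (\<chi> j. if j \<in> insert i S then x $ j else 0)" for n
      using 2 by (auto simp: vec_eq_iff)
    moreover have "(\<Prod>k\<in>S. fact ((n + (\<chi> j. if j = i then x $ i else 0)) $ k + x $ k)
          / fact ((n + (\<chi> j. if j = i then x $ i else 0)) $ k))
        = (\<Prod>k\<in>S. fact (n $ k + x $ k) / (fact (n $ k) :: real))" for n
      using 2 by (intro prod.cong) auto
    moreover have "Finite_Set.fold (\<lambda>i. partial i ^^ (x $ i)) f (insert i S)
        = (partial i ^^ (x $ i)) (Finite_Set.fold (\<lambda>i. partial i ^^ (x $ i)) f S)"
      using 2 by (intro fold_insert) auto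
    ultimately show ?case
      unfolding 2(3) partial_funpow using 2(1,2) by (simp add: mult.assoc)
  qed
  from this[of UNIV] show ?thesis
    by (simp add: mixed_partial_def mfact_def prod_dividef)
qed

end

theory Submission
  imports Defs
begin

text \<open>
  Let \<open>a n = n! \<mu> n\<close> and let \<open>E i\<close> be the shift \<open>(E i c) n = c (n + e i)\<close>. ULC says that the array \<open>a\<close> is
  Lorentzian: \<open>c n (D\<^sup>2 c) n \<le> ((D c) n)\<^sup>2\<close> for \<open>c = a\<close>, every \<open>n\<close> and every real combination \<open>D\<close> of the shifts.
  The key fact is that \<open>w\<^sub>0 + \<Sum> w i E i\<close> with nonnegative coefficients maps Lorentzian arrays to
  Lorentzian arrays; this is a trickle-down (Perron--Frobenius) argument for the homogenised quadratic
  forms. Applied to powers of \<open>D = \<Sum> \<theta> i E i\<close>, it makes \<open>(D\<^sup>j a) n\<close> a log-concave sequence in \<open>j\<close>, so all the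
  series converge. Applied to \<open>(1 + D / m)\<^sup>m\<close> with \<open>m \<rightarrow> \<infinity>\<close>, it shows that \<open>exp D a\<close>, the array of derivatives
  of the generating function at \<open>\<theta>\<close>, is again Lorentzian, which is 1-spectral independence of the tilted
  pinnings; and the polynomials \<open>\<theta> \<mapsto> ((1 + D / m)\<^sup>m c) 0\<close> are log-concave, hence so is their limit, for \<open>c\<close>
  obtained from \<open>a\<close> by any nonnegative directional derivatives. Conversely, each of the conditions gives
  ULC by letting the tilt tend to \<open>0\<close>.
\<close>

section \<open>Trickling down for symmetric nonnegative matrices\<close>

definition bil :: "('i::finite \<Rightarrow> 'i \<Rightarrow> real) \<Rightarrow> ('i \<Rightarrow> real) \<Rightarrow> ('i \<Rightarrow> real) \<Rightarrow> real"
  where "bil A u v = (\<Sum>a\<in>UNIV. \<Sum>b\<in>UNIV. A a b * u a * v b)"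

lemma bil_add_left: "bil A (\<lambda>a. u a + v a) w = bil A u w + bil A v w"
  by (simp add: bil_def algebra_simps sum.distrib)

lemma bil_add_right: "bil A w (\<lambda>a. u a + v a) = bil A w u + bil A w v"
  by (simp add: bil_def algebra_simps sum.distrib)

lemma bil_scale_left: "bil A (\<lambda>a. r * u a) w = r * bil A u w"
  by (simp add: bil_def sum_distrib_left mult_ac)

lemma bil_scale_right: "bil A w (\<lambda>a. r * u a) = r * bil A w u"
  by (simp add: bil_def sum_distrib_left mult_ac)

lemmas bil_simps = bil_add_left bil_add_right bil_scale_left bil_scale_right

lemma bil_commute:
  assumes "\<And>a b. A a b = A b a"
  shows "bil A u v = bil A v u"
  unfolding bil_def by (subst sum.swap) (simp add: assms mult_ac)

lemma bil_rows: "bil A u v = (\<Sum>a\<in>UNIV. u a * (\<Sum>b\<in>UNIV. A a b * v b))"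
  by (simp add: bil_def sum_distrib_left mult_ac)

text \<open>A form that is nonpositive on a hyperplane has at most one positive direction. If
  \<open>bil A e e\<close> is positive, the vector \<open>u + t e\<close> in the hyperplane of
  \<open>w\<close> gives a quadratic in t with positive leading coefficient and a nonpositive value,
  so its discriminant is nonnegative.\<close>

lemma reverse_Cauchy_Schwarz:
  assumes sym: "\<And>a b. A a b = A b a"
    and neg: "\<And>u. bil A w u = 0 \<Longrightarrow> bil A u u \<le> 0"
    and e: "0 \<le> bil A e e"
  shows "bil A e e * bil A u u \<le> (bil A e u)\<^sup>2"
proof (cases "bil A e e = 0")
  case False
  with e have epos: "0 < bil A e e" by simp
  then have we: "bil A w e \<noteq> 0" using neg[of e] by auto
  define t where "t = - bil A w u / bil A w e"
  have "bil A w (\<lambda>a. u a + t * e a) = 0"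
    unfolding bil_simps t_def using we by simp
  from neg[OF this] have *: "bil A u u + 2 * t * bil A e u + t\<^sup>2 * bil A e e \<le> 0"
    by (simp add: bil_simps bil_commute[of A u e, OF sym] power2_eq_square algebra_simps)
  have "0 \<le> (t * bil A e e + bil A e u)\<^sup>2" by simp
  also have "\<dots> = bil A e e * (bil A u u + 2 * t * bil A e u + t\<^sup>2 * bil A e e)
      + ((bil A e u)\<^sup>2 - bil A e e * bil A u u)"
    by (simp add: power2_eq_square algebra_simps)
  also have "\<dots> \<le> 0 + ((bil A e u)\<^sup>2 - bil A e e * bil A u u)"
    using * epos by (intro add_right_mono mult_nonneg_nonpos) auto
  finally show ?thesis by simp
qed simp

text \<open>First-order optimality: otherwise a small t of sign opposite to \<open>p\<close> would
  make the expression negative.\<close>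

lemma linear_coeff_eq_0:
  fixes p q :: real
  assumes "\<And>t. 0 \<le> t * p + t\<^sup>2 * q"
  shows "p = 0"
proof (rule ccontr)
  assume p: "p \<noteq> 0"
  define t where "t = - p / (\<bar>q\<bar> + 1)"
  have "t * p + t\<^sup>2 * q \<le> t * p + t\<^sup>2 * \<bar>q\<bar>" by (intro add_left_mono mult_left_mono) auto
  also have "\<dots> = - (p\<^sup>2 / (\<bar>q\<bar> + 1)\<^sup>2)"
  proof -
    have "\<bar>q\<bar> + 1 \<noteq> 0" by linarith
    moreover have "r \<noteq> 0 \<Longrightarrow> - p / r * p + (- p / r)\<^sup>2 * (r - 1) = - (p\<^sup>2 / r\<^sup>2)" for r :: real
      by (simp add: divide_simps power2_eq_square) (simp add: algebra_simps)
    ultimately show ?thesis unfolding t_def by (metis add_diff_cancel_right')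
  qed
  also have "\<dots> < 0" using p by (simp add: add_nonneg_eq_0_iff)
  finally show False using assms[of t] by simp
qed

text \<open>Lagrange multipliers: \<open>u\<close> maximises \<open>bil A u u\<close> on the
  \<delta>-weighted unit sphere of the hyperplane given by \<open>W\<close>. Stationarity covers the
  directions inside the hyperplane; the remaining direction \<open>W\<close> is covered because
  \<open>W\<close> is itself an eigenvector relative to \<delta>.\<close>

lemma constrained_eigenvector:
  fixes A :: "'i::finite \<Rightarrow> 'i \<Rightarrow> real" and \<delta> W :: "'i \<Rightarrow> real"
  assumes sym: "\<And>a b. A a b = A b a" and \<delta>: "\<And>a. 0 < \<delta> a"
    and eig: "\<And>a. (\<Sum>b\<in>UNIV. A a b * W b) = \<delta> a * W a"
    and WW: "bil A W W \<noteq> 0"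
    and u0: "bil A W u0 = 0" "0 < bil A u0 u0"
  obtains u l where "0 < l" "u \<noteq> (\<lambda>_. 0)" "bil A W u = 0"
    "\<And>a. (\<Sum>b\<in>UNIV. A a b * u b) = l * \<delta> a * u a"
proof -
  define N where "N u v = (\<Sum>a\<in>UNIV. \<delta> a * u a * v a)" for u v :: "'i \<Rightarrow> real"
  have N_simps: "N (\<lambda>a. u a + v a) w = N u w + N v w" "N w (\<lambda>a. u a + v a) = N w u + N w v"
    "N (\<lambda>a. r * u a) w = r * N u w" "N w (\<lambda>a. r * u a) = r * N w u" "N u v = N v u" for u v w r
    by (simp_all add: N_def algebra_simps sum.distrib sum_distrib_left)
  have N_pos: "0 < N u u" if "u a \<noteq> 0" for u a
    unfolding N_def
  proof (rule sum_pos2[of _ a])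
    show "0 < \<delta> a * u a * u a" using that \<delta>[of a] by (simp add: mult.assoc zero_less_mult_iff) linarith
    show "0 \<le> \<delta> b * u b * u b" for b using \<delta>[of b] by (simp add: mult.assoc)
  qed auto
  \<comment> \<open>By \<open>eig\<close>, orthogonality to \<open>W\<close> under \<open>A\<close>
    and under the weighted product \<open>N\<close> is the same condition.\<close>
  have NW: "N W v = bil A W v" for v
  proof -
    have "bil A W v = bil A v W" by (rule bil_commute[OF sym])
    also have "\<dots> = (\<Sum>a\<in>UNIV. v a * (\<delta> a * W a))" by (simp only: bil_rows eig)
    finally show ?thesis by (simp add: N_def mult_ac)
  qed
  have vn: "($) (vec_lambda v) = v" for v :: "'i \<Rightarrow> real" by (rule ext) simp
  define S where "S = {u :: real ^ 'i. bil A W (($) u) = 0 \<and> N (($) u) (($) u) = 1}"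
  have "closed S" unfolding S_def bil_def N_def
    by (intro closed_Collect_conj closed_Collect_eq continuous_intros)
  moreover have "bounded S"
  proof -
    define m where "m = Min (range \<delta>)"
    have m: "0 < m" "\<And>a. m \<le> \<delta> a" using \<delta> by (auto simp: m_def)
    have "norm u \<le> sqrt (1 / m)" if "u \<in> S" for u
    proof -
      have "m * (norm u)\<^sup>2 = (\<Sum>a\<in>UNIV. m * (u $ a)\<^sup>2)"
        by (simp add: norm_vec_def L2_set_def sum_nonneg sum_distrib_left)
      also have "\<dots> \<le> N (($) u) (($) u)"
        unfolding N_def by (intro sum_mono) (simp add: power2_eq_square m mult.assoc mult_right_mono)
      finally have "(norm u)\<^sup>2 \<le> 1 / m" using m that by (simp add: S_def field_simps)
      then show ?thesis by (simp add: real_le_rsqrt)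
    qed
    then show ?thesis by (auto simp: bounded_iff)
  qed
  ultimately have "compact S" by (simp add: compact_eq_bounded_closed)
  have normalize: "\<exists>r>0. (\<chi> a. r * v a) \<in> S \<and> r\<^sup>2 * N v v = 1" if "v a \<noteq> 0" "bil A W v = 0" for v a
  proof -
    have Nv: "0 < N v v" using that(1) by (rule N_pos)
    define r where "r = 1 / sqrt (N v v)"
    have r: "0 < r" "r\<^sup>2 * N v v = 1" using Nv by (auto simp: r_def power_divide)
    have "bil A W (\<lambda>a. r * v a) = 0" "N (\<lambda>a. r * v a) (\<lambda>a. r * v a) = 1"
      unfolding bil_simps N_simps(3,4) using r(2) that(2) by (simp_all add: power2_eq_square)
    then show ?thesis using r by (intro exI[of _ r]) (simp add: S_def vn)
  qed
  have "u0 \<noteq> (\<lambda>_. 0)" using u0(2) by (auto simp: bil_def)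
  then obtain a0 where "u0 a0 \<noteq> 0" by (meson ext)
  then obtain r0 where r0: "0 < r0" "(\<chi> a. r0 * u0 a) \<in> S" using normalize u0(1) by blast
  have "continuous_on S (\<lambda>u. bil A (($) u) (($) u))" unfolding bil_def by (intro continuous_intros)
  then obtain us where us: "us \<in> S" "\<And>v. v \<in> S \<Longrightarrow> bil A (($) v) (($) v) \<le> bil A (($) us) (($) us)"
    using continuous_attains_sup[OF \<open>compact S\<close>] r0(2) by blast
  define u where "u = ($) us"
  define l where "l = bil A u u"
  have Wu: "bil A W u = 0" and Nu: "N u u = 1" using us(1) by (auto simp: S_def u_def)
  have "r0\<^sup>2 * bil A u0 u0 \<le> l"
    using us(2)[OF r0(2)] by (simp add: vn l_def u_def bil_simps power2_eq_square mult_ac)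
  then have l: "0 < l" using r0(1) u0(2) by (smt (verit) mult_pos_pos zero_less_power)
  have upper: "bil A v v \<le> l * N v v" if v: "bil A W v = 0" for v
  proof (cases "\<exists>a. v a \<noteq> 0")
    case True
    then obtain r where r: "0 < r" "(\<chi> a. r * v a) \<in> S" "r\<^sup>2 * N v v = 1" using normalize v by blast
    have "r\<^sup>2 * bil A v v \<le> l * (r\<^sup>2 * N v v)"
      using us(2)[OF r(2)] unfolding r(3) by (simp add: vn l_def u_def bil_simps power2_eq_square mult_ac)
    then show ?thesis using r(1) by (simp add: mult.left_commute)
  next
    case False
    then show ?thesis by (simp add: bil_def N_def)
  qed
  \<comment> \<open>Perturbing the maximiser to \<open>u + t v\<close> cannot beat the bound
    \<open>upper\<close>, so the term linear in t vanishes.\<close>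
  have orth: "bil A u v = l * N u v" if v: "bil A W v = 0" for v
  proof -
    have "0 \<le> t * (2 * (l * N u v - bil A u v)) + t\<^sup>2 * (l * N v v - bil A v v)" for t
    proof -
      have "bil A W (\<lambda>a. u a + t * v a) = 0" using v Wu by (simp add: bil_simps)
      from upper[OF this] show ?thesis
        using Nu by (simp add: bil_simps N_simps(1-4) bil_commute[of A v u, OF sym] N_simps(5)[of v u] l_def[symmetric]
          power2_eq_square algebra_simps)
    qed
    from linear_coeff_eq_0[OF this] show ?thesis by simp
  qed
  \<comment> \<open>Every \<open>v\<close> differs from a vector of the hyperplane by a multiple of
    \<open>W\<close>, and both sides are 0 at \<open>W\<close>.\<close>
  have full: "bil A u v = l * N u v" for v
  proof -
    define t where "t = - bil A W v / bil A W W"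
    have "bil A W (\<lambda>a. v a + t * W a) = 0" unfolding bil_simps t_def using WW by simp
    from orth[OF this] show ?thesis
      using Wu by (simp add: bil_simps N_simps(1-4) bil_commute[of A u W, OF sym] N_simps(5)[of u W] NW)
  qed
  show thesis
  proof
    show "0 < l" "bil A W u = 0" by fact+
    show "u \<noteq> (\<lambda>_. 0)" using Nu by (auto simp: N_def)
    fix a
    have "(\<Sum>b\<in>UNIV. A a b * u b) = bil A (\<lambda>b. if b = a then 1 else 0) u"
      by (simp add: bil_rows if_distrib[of "\<lambda>x. x * _"] cong: if_cong)
    also have "\<dots> = bil A u (\<lambda>b. if b = a then 1 else 0)" by (rule bil_commute[OF sym])
    also have "\<dots> = l * \<delta> a * u a" unfolding full by (simp add: N_def if_distrib cong: if_cong)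
    finally show "(\<Sum>b\<in>UNIV. A a b * u b) = l * \<delta> a * u a" .
  qed
qed

text \<open>
  A maximiser \<open>u\<close> of \<open>u\<^sup>T A u\<close> on the complement of \<open>W\<close>, normalised with respect to the weights
  \<open>\<delta> = A W / W\<close>, satisfies \<open>A u = l \<delta> u\<close>. The hypothesis \<open>local\<close> gives \<open>l \<le> l\<^sup>2\<close>, so a positive \<open>l\<close>
  is at least 1, whereas \<open>W\<close> is the Perron eigenvector and its eigenvalue 1 is simple.
\<close>

lemma trickle_down:
  fixes A :: "'i::finite \<Rightarrow> 'i \<Rightarrow> real" and W :: "'i \<Rightarrow> real"
  assumes sym: "\<And>a b. A a b = A b a" and nonneg: "\<And>a b. 0 \<le> A a b"
    and W: "\<And>a. 0 \<le> W a" and z: "0 < W z" and conn: "\<And>a. 0 < W a \<Longrightarrow> 0 < A z a"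
    and zero: "\<And>a b. W a = 0 \<Longrightarrow> A a b = 0"
    and local: "\<And>u. bil A u u \<le>
      (\<Sum>a | 0 < W a. W a * (\<Sum>b\<in>UNIV. A a b * u b)\<^sup>2 / (\<Sum>b\<in>UNIV. A a b * W b))"
    and u0: "bil A W u0 = 0"
  shows "bil A u0 u0 \<le> 0"
proof (rule ccontr)
  assume "\<not> ?thesis"
  then have u0': "0 < bil A u0 u0" by simp
  have AW: "0 < (\<Sum>b\<in>UNIV. A a b * W b)" if "0 < W a" for a
    using that z conn[OF that] by (intro sum_pos2[of _ z]) (auto simp: sym[of a z] nonneg W)
  \<comment> \<open>Off the support of \<open>W\<close> the rows of \<open>A\<close> vanish and
    \<open>eig\<close> reads 0 = 0; the default 1 keeps \<delta> positive there.\<close>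
  define \<delta> where "\<delta> a = (if 0 < W a then (\<Sum>b\<in>UNIV. A a b * W b) / W a else 1)" for a
  have \<delta>: "0 < \<delta> a" for a using AW by (auto simp: \<delta>_def)
  have W0: "W a = 0" if "\<not> 0 < W a" for a using that W[of a] by simp
  have eig: "(\<Sum>b\<in>UNIV. A a b * W b) = \<delta> a * W a" for a
    by (cases "0 < W a") (auto simp: \<delta>_def W0 zero)
  have "0 < bil A W W" unfolding bil_rows
    using z AW[OF z] by (intro sum_pos2[of _ z]) (auto intro!: mult_nonneg_nonneg sum_nonneg nonneg W)
  then obtain u l where u: "0 < l" "u \<noteq> (\<lambda>_. 0)" "bil A W u = 0"
    "\<And>a. (\<Sum>b\<in>UNIV. A a b * u b) = l * \<delta> a * u a"
    using constrained_eigenvector[of A \<delta> W u0, OF sym \<delta> eig _ u0 u0'] by (metis less_irrefl)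
  have u_zero: "u a = 0" if "\<not> 0 < W a" for a
    using u(4)[of a] u(1) \<delta>[of a] by (simp add: zero W0[OF that])
  define M where "M = (\<Sum>a\<in>UNIV. \<delta> a * (u a)\<^sup>2)"
  have lM: "bil A u u = l * M" unfolding bil_rows u(4)
    by (simp add: M_def sum_distrib_left power2_eq_square mult_ac)
  have "bil A u u \<le> (\<Sum>a | 0 < W a. l\<^sup>2 * (\<delta> a * (u a)\<^sup>2))"
  proof (rule order.trans[OF local], rule sum_mono)
    fix a assume "a \<in> {a. 0 < W a}"
    then have "W a \<noteq> 0" "\<delta> a \<noteq> 0" using \<delta>[of a] by auto
    then show "W a * (\<Sum>b\<in>UNIV. A a b * u b)\<^sup>2 / (\<Sum>b\<in>UNIV. A a b * W b) \<le> l\<^sup>2 * (\<delta> a * (u a)\<^sup>2)"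
      unfolding u(4) eig by (simp add: power2_eq_square)
  qed
  also have "\<dots> = l\<^sup>2 * M" unfolding M_def sum_distrib_left
    by (rule sum.mono_neutral_left) (auto simp: u_zero)
  \<comment> \<open>Cancelling \<open>l > 0\<close> leaves \<open>M \<le> l * M\<close>, and
    \<open>l * M\<close> is \<open>bil A u u\<close>.\<close>
  finally have "l * M \<le> l * (l * M)" by (simp add: lM power2_eq_square mult_ac)
  then have "M \<le> bil A u u" using u(1) by (simp add: lM)
  \<comment> \<open>In the ratios to the Perron vector, \<open>2 * (M - bil A u u)\<close> is a
    Dirichlet form with nonnegative weights; the previous inequality forces it to vanish.\<close>
  define x where "x a = u a / W a" for a
  have ux: "u a = W a * x a" for a by (cases "0 < W a") (auto simp: x_def u_zero)
  have "M = (\<Sum>a\<in>UNIV. \<Sum>b\<in>UNIV. A a b * W a * W b * (x a)\<^sup>2)" unfolding M_def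
  proof (rule sum.cong)
    fix a
    have "\<delta> a * (u a)\<^sup>2 = (\<delta> a * W a) * (W a * (x a)\<^sup>2)" by (simp add: ux power2_eq_square)
    also have "\<dots> = (\<Sum>b\<in>UNIV. A a b * W a * W b * (x a)\<^sup>2)"
      unfolding eig[symmetric] sum_distrib_right by (simp add: mult_ac)
    finally show "\<delta> a * (u a)\<^sup>2 = (\<Sum>b\<in>UNIV. A a b * W a * W b * (x a)\<^sup>2)" .
  qed simp
  moreover from this have "M = (\<Sum>a\<in>UNIV. \<Sum>b\<in>UNIV. A a b * W a * W b * (x b)\<^sup>2)"
    by (subst sum.swap) (simp add: sym mult_ac)
  ultimately have "2 * (M - bil A u u) = (\<Sum>a\<in>UNIV. \<Sum>b\<in>UNIV. A a b * W a * W b * (x a - x b)\<^sup>2)"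
    by (simp add: bil_def ux power2_diff algebra_simps sum.distrib sum_subtractf sum_distrib_left)
  with \<open>M \<le> bil A u u\<close> have le0: "(\<Sum>a\<in>UNIV. \<Sum>b\<in>UNIV. A a b * W a * W b * (x a - x b)\<^sup>2) \<le> 0" by simp
  \<comment> \<open>The index \<open>z\<close> is joined to the whole support, so a vanishing
    Dirichlet form makes \<open>x\<close> constant there.\<close>
  have "x a = x z" if a: "0 < W a" for a
  proof (rule ccontr)
    assume "x a \<noteq> x z"
    then have "0 < A z a * W z * W a * (x z - x a)\<^sup>2"
      using z a conn by (auto intro!: mult_pos_pos)
    also have "\<dots> \<le> (\<Sum>b\<in>UNIV. A z b * W z * W b * (x z - x b)\<^sup>2)"
      by (rule member_le_sum) (auto intro!: mult_nonneg_nonneg nonneg W)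
    also have "\<dots> \<le> (\<Sum>a\<in>UNIV. \<Sum>b\<in>UNIV. A a b * W a * W b * (x a - x b)\<^sup>2)"
      by (rule member_le_sum[where f="\<lambda>a. \<Sum>b\<in>UNIV. A a b * W a * W b * (x a - x b)\<^sup>2"])
         (auto intro!: mult_nonneg_nonneg sum_nonneg nonneg W)
    finally show False using le0 by simp
  qed
  then have u_eq: "u = (\<lambda>a. x z * W a)" by (metis ux u_zero W0 mult.commute mult_zero_right)
  then have "x z * bil A W W = 0" using u(3) by (metis bil_scale_right)
  with \<open>0 < bil A W W\<close> have "x z = 0" by simp
  with u_eq u(2) show False by simp
qed

section \<open>Shift operators and Lorentzian arrays\<close>

definition opt_unit_vec :: "'d::finite option \<Rightarrow> nat ^ 'd"
  where "opt_unit_vec a = (case a of None \<Rightarrow> 0 | Some i \<Rightarrow> unit_vec i)"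

definition shift_op :: "('d::finite option \<Rightarrow> real) \<Rightarrow> (nat ^ 'd \<Rightarrow> real) \<Rightarrow> nat ^ 'd \<Rightarrow> real"
  where "shift_op W c n = (\<Sum>a\<in>UNIV. W a * c (n + opt_unit_vec a))"

lemma opt_unit_vec_simps [simp]: "opt_unit_vec None = 0" "opt_unit_vec (Some i) = unit_vec i"
  by (simp_all add: opt_unit_vec_def)

lemma sum_option: "(\<Sum>a\<in>UNIV. f a) = f None + (\<Sum>i\<in>UNIV. f (Some i))"
  for f :: "'d::finite option \<Rightarrow> real"
  by (simp add: UNIV_option_conv sum.reindex)

lemma le_add_vec: "n \<le> n + m" for n m :: "nat ^ 'd"
  by (simp add: less_eq_vec_def)

lemma shift_op_add: "shift_op W (\<lambda>n. f n + g n) n = shift_op W f n + shift_op W g n"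
  by (simp add: shift_op_def algebra_simps sum.distrib)

lemma shift_op_scale: "shift_op W (\<lambda>n. r * f n) n = r * shift_op W f n"
  by (simp add: shift_op_def sum_distrib_left mult_ac)

lemma shift_op_add_left: "shift_op (\<lambda>a. U a + V a) f n = shift_op U f n + shift_op V f n"
  by (simp add: shift_op_def algebra_simps sum.distrib)

lemma shift_op_scale_left: "shift_op (\<lambda>a. r * U a) f n = r * shift_op U f n"
  by (simp add: shift_op_def sum_distrib_left mult_ac)

lemma shift_op_bil: "shift_op U (shift_op V c) n = bil (\<lambda>a b. c (n + opt_unit_vec a + opt_unit_vec b)) U V"
  by (simp add: shift_op_def bil_rows mult_ac)

lemma shift_op_commute: "shift_op U (shift_op V c) = shift_op V (shift_op U c)"
  by (rule ext) (simp add: shift_op_bil, rule bil_commute, simp add: add_ac)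

lemma shift_op_unit [simp]: "shift_op (\<lambda>a. if a = None then 1 else 0) c = c"
  by (rule ext) (simp add: shift_op_def if_distrib[of "\<lambda>x. x * _"] cong: if_cong)

text \<open>
  The index \<open>None\<close> is the homogenising direction. Arrays \<open>c\<close> stand for the derivatives at the origin
  of a power series, and the quadratic condition says that \<open>(\<alpha>, \<beta>) \<mapsto> c (n + \<alpha> + \<beta>)\<close> has Lorentzian
  signature on the homogenised space; without the homogenising direction it is the ULC condition.
\<close>

definition lorentzian :: "(nat ^ 'd::finite \<Rightarrow> real) \<Rightarrow> bool"
  where "lorentzian c \<longleftrightarrow> (\<forall>n. 0 \<le> c n) \<and> (\<forall>m n. m \<le> n \<longrightarrow> 0 < c n \<longrightarrow> 0 < c m) \<and>
    (\<forall>n U. c n * shift_op U (shift_op U c) n \<le> (shift_op U c n)\<^sup>2)"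

lemma lorentzianD:
  assumes "lorentzian c"
  shows "0 \<le> c n" "m \<le> n \<Longrightarrow> 0 < c n \<Longrightarrow> 0 < c m"
    "c n * shift_op U (shift_op U c) n \<le> (shift_op U c n)\<^sup>2"
  using assms by (auto simp: lorentzian_def)

lemma lorentzian_zero: "lorentzian c \<Longrightarrow> c n = 0 \<Longrightarrow> c (n + m) = 0"
  using lorentzianD(1)[of c "n + m"] lorentzianD(2)[of c n "n + m"] le_add_vec[of n m] by force

lemma shift_op_nonneg: "(\<And>n. 0 \<le> c n) \<Longrightarrow> (\<And>a. 0 \<le> W a) \<Longrightarrow> 0 \<le> shift_op W c n"
  by (auto simp: shift_op_def intro!: sum_nonneg)

text \<open>By the quadratic condition the Hessian form at \<open>n\<close> is nonpositive on the
  hyperplane of the unit vector at \<open>None\<close>. The matrix version then gives the reversed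
  inequality for every \<open>W\<close> of nonnegative square.\<close>

lemma lorentzian_reverse_Cauchy_Schwarz:
  assumes c: "lorentzian c" and W: "0 \<le> shift_op W (shift_op W c) n"
  shows "shift_op W (shift_op W c) n * shift_op U (shift_op U c) n \<le> (shift_op W (shift_op U c) n)\<^sup>2"
  unfolding shift_op_bil
proof (rule reverse_Cauchy_Schwarz[where w="\<lambda>a. if a = None then 1 else 0"])
  let ?A = "\<lambda>a b. c (n + opt_unit_vec a + opt_unit_vec b)"
  show "?A a b = ?A b a" for a b by (simp add: add_ac)
  show "0 \<le> bil ?A W W" using W by (simp add: shift_op_bil)
  fix u assume "bil ?A (\<lambda>a. if a = None then 1 else 0) u = 0"
  then have 0: "shift_op u c n = 0" by (simp flip: shift_op_bil)
  show "bil ?A u u \<le> 0"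
  proof (cases "c n = 0")
    case True
    then show ?thesis using lorentzian_zero[OF c True] by (simp add: bil_def add.assoc)
  next
    case False
    then have "0 < c n" using lorentzianD(1)[OF c, of n] by simp
    moreover have "c n * bil ?A u u \<le> 0" using lorentzianD(3)[OF c, of n u] 0 by (simp add: shift_op_bil)
    ultimately show ?thesis by (simp add: mult_le_0_iff)
  qed
qed

text \<open>Trickle-down for the Hessian \<open>A\<close> of \<open>shift_op W c\<close> at
  \<open>n\<close>: \<open>bil A u u\<close> is the \<open>W\<close>-weighted sum of the Hessian
  forms of \<open>c\<close> at the points \<open>n + opt_unit_vec a\<close>, and reverse
  Cauchy-Schwarz at each of these points bounds it by the matching summand of
  \<open>local\<close>.\<close>

lemma lorentzian_shift_op_pos:
  assumes c: "lorentzian c" and W: "\<And>a. 0 < W a"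
  shows "shift_op W c n * shift_op U (shift_op U (shift_op W c)) n \<le> (shift_op U (shift_op W c) n)\<^sup>2"
proof (cases "c n = 0")
  case True
  have "shift_op W c n = 0"
    by (subst shift_op_def) (simp add: lorentzian_zero[OF c True])
  then show ?thesis by simp
next
  case False
  note c0 = lorentzianD(1)[OF c]
  have cn: "0 < c n" using False c0[of n] by simp
  define A where "A a b = shift_op W c (n + opt_unit_vec a + opt_unit_vec b)" for a b
  \<comment> \<open>\<open>W\<close> cut down to the directions that stay in the support of
    \<open>c\<close>. The rows of \<open>A\<close> in all other directions vanish, so
    \<open>A\<close> has the same product with \<open>W\<close> and \<open>W'\<close>.\<close>
  define W' where "W' a = (if 0 < c (n + opt_unit_vec a) then W a else 0)" for a
  have sym: "A a b = A b a" for a b by (simp add: A_def add_ac)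
  have nonneg: "0 \<le> A a b" for a b unfolding A_def by (intro shift_op_nonneg c0 less_imp_le[OF W])
  have off: "c (n + opt_unit_vec a + m) = 0" if "\<not> 0 < W' a" for a m
    using that c0[of "n + opt_unit_vec a"] W[of a] lorentzian_zero[OF c, of "n + opt_unit_vec a" m]
    by (auto simp: W'_def split: if_splits)
  have zero: "A a b = 0" if "\<not> 0 < W' a" for a b
    unfolding A_def shift_op_def using off[OF that] by (simp add: add.assoc)
  have AW': "(\<Sum>b\<in>UNIV. A a b * W' b) = (\<Sum>b\<in>UNIV. A a b * W b)" for a
    using zero by (intro sum.cong refl) (force simp: W'_def sym[of a])
  have row: "(\<Sum>b\<in>UNIV. A a b * u b) = shift_op u (shift_op W c) (n + opt_unit_vec a)" for a u
    by (simp add: A_def shift_op_def[of u] mult_ac)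
  \<comment> \<open>\<open>None\<close> serves as the hub: one summand of \<open>A None a\<close> is
    \<open>W None * c (n + opt_unit_vec a)\<close>.\<close>
  have conn: "0 < A None a" if "0 < W' a" for a
    unfolding A_def shift_op_def using that
    by (intro sum_pos2[of _ None]) (auto simp: W c0 W'_def less_imp_le split: if_splits)
  have z: "0 < W' None" using cn W by (simp add: W'_def)
  have W'0: "0 \<le> W' a" for a using W by (simp add: W'_def less_imp_le)
  have local: "bil A u u \<le>
      (\<Sum>a | 0 < W' a. W' a * (\<Sum>b\<in>UNIV. A a b * u b)\<^sup>2 / (\<Sum>b\<in>UNIV. A a b * W' b))" for u
  proof -
    have "bil A u u = shift_op W (shift_op u (shift_op u c)) n"
      unfolding A_def shift_op_bil[symmetric] by (simp add: shift_op_commute[of W])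
    also have "\<dots> = (\<Sum>a | 0 < W' a. W a * shift_op u (shift_op u c) (n + opt_unit_vec a))"
      by (subst shift_op_def, rule sum.mono_neutral_right)
         (auto simp: shift_op_bil bil_def off[unfolded add.assoc] add.assoc)
    also have "\<dots> \<le> (\<Sum>a | 0 < W' a. W' a * (\<Sum>b\<in>UNIV. A a b * u b)\<^sup>2 / (\<Sum>b\<in>UNIV. A a b * W' b))"
    proof (rule sum_mono)
      fix a assume "a \<in> {a. 0 < W' a}"
      then have a: "0 < W' a" by simp
      have "0 < A a None * W None" using conn[OF a] W[of None] by (simp add: sym)
      also have "\<dots> \<le> (\<Sum>b\<in>UNIV. A a b * W b)"
        by (rule member_le_sum) (auto simp: nonneg less_imp_le W)
      finally have pos: "0 < shift_op W (shift_op W c) (n + opt_unit_vec a)" by (simp add: row)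
      have "shift_op u (shift_op u c) (n + opt_unit_vec a)
          \<le> (shift_op u (shift_op W c) (n + opt_unit_vec a))\<^sup>2 / shift_op W (shift_op W c) (n + opt_unit_vec a)"
        using lorentzian_reverse_Cauchy_Schwarz[OF c, of W "n + opt_unit_vec a" u] pos
        by (simp add: pos_le_divide_eq shift_op_commute[of u W] mult.commute)
      moreover have "W' a = W a" using a by (auto simp: W'_def split: if_splits)
      ultimately show "W a * shift_op u (shift_op u c) (n + opt_unit_vec a)
          \<le> W' a * (\<Sum>b\<in>UNIV. A a b * u b)\<^sup>2 / (\<Sum>b\<in>UNIV. A a b * W' b)"
        unfolding AW' unfolding row times_divide_eq_right[symmetric]
        using W[of a] by (simp add: mult_left_mono del: times_divide_eq_right)
    qed
    finally show ?thesis .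
  qed
  have neg: "bil A u u \<le> 0" if "bil A W' u = 0" for u
    by (rule trickle_down[OF sym nonneg W'0 z conn _ local that]) (auto intro: zero)
  \<comment> \<open>The square of the unit vector at \<open>None\<close> is
    \<open>shift_op W c n\<close>, so this instance is the claim.\<close>
  have "bil A (\<lambda>a. if a = None then 1 else 0) (\<lambda>a. if a = None then 1 else 0) * bil A U U
      \<le> (bil A (\<lambda>a. if a = None then 1 else 0) U)\<^sup>2"
    by (rule reverse_Cauchy_Schwarz[OF sym neg]) (auto simp: bil_def intro!: sum_nonneg nonneg)
  then show ?thesis unfolding A_def shift_op_bil[symmetric] by simp
qed

text \<open>Nonnegative coefficients are limits of the positive ones \<open>W a + e\<close> as e
  decreases to 0, and the inequality involves finitely many entries.\<close>

lemma lorentzian_shift_op: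
  assumes c: "lorentzian c" and W: "\<And>a. 0 \<le> W a"
  shows "lorentzian (shift_op W c)"
  unfolding lorentzian_def
proof (intro conjI allI impI)
  note c0 = lorentzianD(1)[OF c]
  show nn: "0 \<le> shift_op W c n" for n by (intro shift_op_nonneg c0 W)
  show "0 < shift_op W c m" if "m \<le> n" "0 < shift_op W c n" for m n
  proof -
    \<comment> \<open>A positive value has a positive summand, which stays positive on moving down
      to \<open>m\<close>.\<close>
    have "\<exists>a. 0 < W a * c (n + opt_unit_vec a)"
    proof (rule ccontr)
      assume "\<not> ?thesis"
      then have "shift_op W c n \<le> 0" unfolding shift_op_def by (intro sum_nonpos) (simp add: not_less)
      with that show False by simp
    qed
    then obtain a where a: "0 < W a" "0 < c (n + opt_unit_vec a)"
      using W c0 by (metis less_eq_real_def mult_zero_left mult_zero_right less_irrefl)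
    have "m + opt_unit_vec a \<le> n + opt_unit_vec a" using that by (simp add: less_eq_vec_def)
    then have "0 < c (m + opt_unit_vec a)" using a lorentzianD(2)[OF c] by blast
    then show ?thesis unfolding shift_op_def using a
      by (intro sum_pos2[of _ a]) (auto simp: W c0)
  qed
  fix n U
  let ?V = "\<lambda>e a. W a + e * 1"
  show "shift_op W c n * shift_op U (shift_op U (shift_op W c)) n \<le> (shift_op U (shift_op W c) n)\<^sup>2"
  proof (rule tendsto_le[of "at_right (0::real)"])
    show "\<forall>\<^sub>F e in at_right 0. shift_op (?V e) c n * shift_op U (shift_op U (shift_op (?V e) c)) n
        \<le> (shift_op U (shift_op (?V e) c) n)\<^sup>2"
      using eventually_at_right_less[of "0::real"]
    proof eventually_elim
      case (elim e)
      show ?case by (rule lorentzian_shift_op_pos[OF c]) (use W elim in \<open>simp add: add_nonneg_pos\<close>)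
    qed
    have eq: "shift_op (?V e) c = (\<lambda>n. shift_op W c n + e * shift_op (\<lambda>_. 1) c n)" for e
      by (rule ext) (simp only: shift_op_add_left shift_op_scale_left)
    have eq': "shift_op U (\<lambda>n. f n + e * g n) = (\<lambda>n. shift_op U f n + e * shift_op U g n)" for f g e
      by (rule ext) (simp only: shift_op_add shift_op_scale)
    show "((\<lambda>e. shift_op (?V e) c n * shift_op U (shift_op U (shift_op (?V e) c)) n) \<longlongrightarrow>
        shift_op W c n * shift_op U (shift_op U (shift_op W c)) n) (at_right 0)"
      "((\<lambda>e. (shift_op U (shift_op (?V e) c) n)\<^sup>2) \<longlongrightarrow> (shift_op U (shift_op W c) n)\<^sup>2) (at_right 0)"
      unfolding eq eq' by (auto intro!: tendsto_eq_intros)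
  qed simp
qed

section \<open>Exponentials of directional shifts\<close>

definition homog :: "real \<Rightarrow> real ^ 'd::finite \<Rightarrow> 'd option \<Rightarrow> real"
  where "homog t v a = (case a of None \<Rightarrow> t | Some i \<Rightarrow> v $ i)"

definition dir_op :: "real ^ 'd::finite \<Rightarrow> (nat ^ 'd \<Rightarrow> real) \<Rightarrow> nat ^ 'd \<Rightarrow> real"
  where "dir_op v = shift_op (homog 0 v)"

text \<open>
  If \<open>c\<close> is the array of derivatives of \<open>g\<close> at the origin, then \<open>exp_op \<theta> c x\<close> is the mixed partial
  derivative \<open>\<partial>\<^sup>x g\<close> at \<open>\<theta>\<close>, i.e. \<open>exp_op \<theta>\<close> is the exponential of \<^term>\<open>dir_op \<theta>\<close>.
\<close>

definition exp_term :: "real ^ 'd::finite \<Rightarrow> (nat ^ 'd \<Rightarrow> real) \<Rightarrow> nat ^ 'd \<Rightarrow> nat ^ 'd \<Rightarrow> real"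
  where "exp_term \<theta> c x k = c (x + k) * mpower \<theta> k / mfact k"

definition exp_op :: "real ^ 'd::finite \<Rightarrow> (nat ^ 'd \<Rightarrow> real) \<Rightarrow> nat ^ 'd \<Rightarrow> real"
  where "exp_op \<theta> c x = infsum (exp_term \<theta> c x) UNIV"

definition level :: "nat \<Rightarrow> (nat ^ 'd::finite) set"
  where "level j = {k. (\<Sum>i\<in>UNIV. k $ i) = j}"

lemma homog_simps [simp]: "homog t v None = t" "homog t v (Some i) = v $ i"
  by (simp_all add: homog_def)

lemma homog_nonneg: "0 \<le> t \<Longrightarrow> (\<And>i. 0 \<le> v $ i) \<Longrightarrow> 0 \<le> homog t v a"
  by (simp add: homog_def split: option.split)

lemma dir_op_eq: "dir_op v c n = (\<Sum>i\<in>UNIV. v $ i * c (n + unit_vec i))"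
  by (simp add: dir_op_def shift_op_def sum_option)

lemma shift_op_homog: "shift_op (homog t v) c n = t * c n + dir_op v c n"
  by (simp add: dir_op_eq shift_op_def sum_option)

lemma lorentzian_dir_op: "lorentzian c \<Longrightarrow> (\<And>i. 0 \<le> v $ i) \<Longrightarrow> lorentzian (dir_op v c)"
  unfolding dir_op_def by (intro lorentzian_shift_op homog_nonneg) auto

lemma lorentzian_funpow:
  "lorentzian c \<Longrightarrow> (\<And>a. 0 \<le> W a) \<Longrightarrow> lorentzian ((shift_op W ^^ m) c)"
  by (induction m) (auto intro: lorentzian_shift_op)

lemma lorentzian_dir_op_funpow:
  "lorentzian c \<Longrightarrow> (\<And>i. 0 \<le> v $ i) \<Longrightarrow> lorentzian ((dir_op v ^^ m) c)"
  by (induction m) (auto intro: lorentzian_dir_op)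

section \<open>Expanding the exponential series by total degree\<close>

lemma unit_vec_nth: "unit_vec i $ j = (if j = i then 1 else 0)"
  by (simp add: unit_vec_def axis_def)

lemma mfact_pos [simp]: "0 < mfact n"
  by (auto simp: mfact_def intro!: prod_pos)

lemma mfact_neq_0 [simp]: "mfact n \<noteq> 0"
  using mfact_pos[of n] by linarith

lemma mfact_0 [simp]: "mfact 0 = 1"
  by (simp add: mfact_def)

lemma mpower_0 [simp]: "mpower \<theta> 0 = 1"
  by (simp add: mpower_def)

lemma mfact_add_unit_vec: "mfact (n + unit_vec i) = (real (n $ i) + 1) * mfact n"
proof -
  have "mfact (n + unit_vec i) = (\<Prod>j\<in>UNIV. (if j = i then real (n $ i) + 1 else 1) * fact (n $ j))"
    unfolding mfact_def by (intro prod.cong) (auto simp: unit_vec_nth)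
  then show ?thesis by (simp add: mfact_def prod.distrib)
qed

lemma mpower_add_unit_vec: "mpower \<theta> (n + unit_vec i) = \<theta> $ i * mpower \<theta> n"
proof -
  have "mpower \<theta> (n + unit_vec i) = (\<Prod>j\<in>UNIV. (if j = i then \<theta> $ i else 1) * (\<theta> $ j) ^ (n $ j))"
    unfolding mpower_def by (intro prod.cong) (auto simp: unit_vec_nth)
  then show ?thesis by (simp add: mpower_def prod.distrib)
qed

lemma mpower_nonneg: "(\<And>i. 0 \<le> \<theta> $ i) \<Longrightarrow> 0 \<le> mpower \<theta> n"
  by (auto simp: mpower_def intro!: prod_nonneg)

lemma exp_term_nonneg:
  "(\<And>n. 0 \<le> c n) \<Longrightarrow> (\<And>i. 0 \<le> \<theta> $ i) \<Longrightarrow> 0 \<le> exp_term \<theta> c x k"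
  by (auto simp: exp_term_def intro!: divide_nonneg_pos mult_nonneg_nonneg mpower_nonneg)

text \<open>Dividing \<open>k!\<close> by \<open>k $ i\<close> lowers one exponent, so a factor
  \<open>k $ i\<close> trades a power of \<open>\<theta> $ i\<close> for a shift of the
  array.\<close>

lemma exp_term_add_unit_vec:
  "real ((k + unit_vec i) $ i) * exp_term \<theta> c x (k + unit_vec i) = \<theta> $ i * exp_term \<theta> c (x + unit_vec i) k"
proof -
  have "r * (u * (t * p) / (r * m)) = t * (u * p / m)" if "r \<noteq> 0" for r u t p m :: real
    using that by simp
  moreover have "real (k $ i) + 1 \<noteq> 0" by linarith
  moreover have "x + (k + unit_vec i) = x + unit_vec i + k" by (simp add: add_ac)
  moreover have "real ((k + unit_vec i) $ i) = real (k $ i) + 1" by (simp add: unit_vec_nth)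
  ultimately show ?thesis
    unfolding exp_term_def mfact_add_unit_vec mpower_add_unit_vec by metis
qed

lemma bij_betw_add_unit_vec: "bij_betw (\<lambda>k. k + unit_vec i) UNIV {k. k $ i \<noteq> 0}"
  by (rule bij_betw_byWitness[where f'="\<lambda>k. k - unit_vec i"]) (auto simp: vec_eq_iff unit_vec_nth)

lemma finite_level: "finite (level j :: (nat ^ 'd::finite) set)"
proof (rule finite_subset)
  show "level j \<subseteq> vec_lambda ` (PiE UNIV (\<lambda>_. {..j}) :: ('d \<Rightarrow> nat) set)"
  proof
    fix k :: "nat ^ 'd" assume "k \<in> level j"
    then have "k $ i \<le> j" for i
      using member_le_sum[of i UNIV "($) k"] by (simp add: level_def)
    then show "k \<in> vec_lambda ` (PiE UNIV (\<lambda>_. {..j}) :: ('d \<Rightarrow> nat) set)"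
      by (intro image_eqI[of _ _ "($) k"]) auto
  qed
qed (simp add: finite_PiE)

text \<open>Euler's identity: on level \<open>Suc j\<close> the coordinates add up to
  \<open>Suc j\<close>, and each factor \<open>k $ i\<close> is absorbed by a shift in direction
  \<open>i\<close>.\<close>

lemma level_sum_step:
  "real (Suc j) * sum (exp_term \<theta> c x) (level (Suc j)) = dir_op \<theta> (\<lambda>x. sum (exp_term \<theta> c x) (level j)) x"
proof -
  have step: "\<theta> $ i * sum (exp_term \<theta> c (x + unit_vec i)) (level j)
      = (\<Sum>k\<in>level (Suc j). real (k $ i) * exp_term \<theta> c x k)" for i
  proof -
    have lev: "k + unit_vec i \<in> level (Suc j) \<longleftrightarrow> k \<in> level j" for k
      by (simp add: level_def unit_vec_nth sum.distrib)
    have inv: "k - unit_vec i + unit_vec i = k" if "k $ i \<noteq> 0" for k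
      using that by (simp add: vec_eq_iff unit_vec_nth)
    have "k - unit_vec i \<in> level j" if "k \<in> level (Suc j)" "k $ i \<noteq> 0" for k
      using lev[of "k - unit_vec i"] that inv[OF that(2)] by (simp only:)
    then have "bij_betw (\<lambda>k. k + unit_vec i) (level j) {k\<in>level (Suc j). k $ i \<noteq> 0}"
      by (intro bij_betw_byWitness[where f'="\<lambda>k. k - unit_vec i"]) (auto simp: lev inv unit_vec_nth)
    then have "(\<Sum>k\<in>level j. real ((k + unit_vec i) $ i) * exp_term \<theta> c x (k + unit_vec i))
        = (\<Sum>k | k \<in> level (Suc j) \<and> k $ i \<noteq> 0. real (k $ i) * exp_term \<theta> c x k)"
      by (rule sum.reindex_bij_betw)
    also have "\<dots> = (\<Sum>k\<in>level (Suc j). real (k $ i) * exp_term \<theta> c x k)"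
      by (rule sum.mono_neutral_left) (auto simp: finite_level)
    finally show ?thesis unfolding exp_term_add_unit_vec by (simp add: sum_distrib_left)
  qed
  have "dir_op \<theta> (\<lambda>x. sum (exp_term \<theta> c x) (level j)) x
      = (\<Sum>k\<in>level (Suc j). \<Sum>i\<in>UNIV. real (k $ i) * exp_term \<theta> c x k)"
    unfolding dir_op_eq step by (rule sum.swap)
  also have "\<dots> = (\<Sum>k\<in>level (Suc j). real (Suc j) * exp_term \<theta> c x k)"
  proof (rule sum.cong[OF refl])
    fix k :: "nat ^ 'a" assume "k \<in> level (Suc j)"
    then have "real (\<Sum>i\<in>UNIV. k $ i) = real (Suc j)" by (simp only: level_def mem_Collect_eq)
    then show "(\<Sum>i\<in>UNIV. real (k $ i) * exp_term \<theta> c x k) = real (Suc j) * exp_term \<theta> c x k"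
      by (simp flip: sum_distrib_right)
  qed
  finally show ?thesis by (simp add: sum_distrib_left)
qed

text \<open>The multinomial theorem: the terms of total degree j form the j-th term of the operator
  exponential.\<close>

lemma level_sum_eq: "sum (exp_term \<theta> c x) (level j) = (dir_op \<theta> ^^ j) c x / fact j"
proof (induction j arbitrary: x)
  case 0
  have "level 0 = {0 :: nat ^ 'a}" by (auto simp: level_def vec_eq_iff)
  then show ?case by (simp add: exp_term_def)
next
  case (Suc j)
  have "real (Suc j) * sum (exp_term \<theta> c x) (level (Suc j))
      = dir_op \<theta> (\<lambda>x. inverse (fact j) * (dir_op \<theta> ^^ j) c x) x"
    unfolding level_sum_step Suc by (simp add: field_simps)
  also have "\<dots> = inverse (fact j) * (dir_op \<theta> ^^ Suc j) c x"
    unfolding dir_op_def shift_op_scale by simp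
  finally show ?case by (simp add: field_simps del: of_nat_Suc)
qed

text \<open>The levels are finite and partition the index set; for nonnegative terms unconditional
  summation agrees with summation level by level, so one ordinary series decides
  convergence.\<close>

lemma has_sum_levels:
  fixes f :: "nat ^ 'd::finite \<Rightarrow> real"
  assumes nonneg: "\<And>k. 0 \<le> f k"
  shows "(f has_sum s) UNIV \<longleftrightarrow> (\<lambda>j. sum f (level j)) sums s"
proof -
  have inner: "((\<lambda>k. (f \<circ> snd) (j, k)) has_sum sum f (level j)) (level j)" for j
    using has_sum_finite[OF finite_level] by (simp add: o_def)
  have bij: "bij_betw snd (Sigma UNIV level) (UNIV :: (nat ^ 'd) set)"
    by (rule bij_betw_byWitness[where f'="\<lambda>k. (\<Sum>i\<in>UNIV. k $ i, k)"]) (auto simp: level_def)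
  have "(f has_sum s) UNIV \<longleftrightarrow> ((f \<circ> snd) has_sum s) (Sigma UNIV level)"
    using has_sum_reindex_bij_betw[OF bij, of f s] by (simp add: o_def)
  also have "\<dots> \<longleftrightarrow> ((\<lambda>j. sum f (level j)) has_sum s) UNIV"
  proof
    assume "((f \<circ> snd) has_sum s) (Sigma UNIV level)"
    then show "((\<lambda>j. sum f (level j)) has_sum s) UNIV" by (rule has_sum_SigmaD) (rule inner)
  next
    assume *: "((\<lambda>j. sum f (level j)) has_sum s) UNIV"
    have "(f \<circ> snd) summable_on (Sigma UNIV level)"
      by (rule summable_on_SigmaI[OF inner]) (use * nonneg in \<open>auto simp: summable_on_def\<close>)
    with * show "((f \<circ> snd) has_sum s) (Sigma UNIV level)" by (intro has_sum_SigmaI[OF inner])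
  qed
  also have "\<dots> \<longleftrightarrow> (\<lambda>j. sum f (level j)) sums s"
    using has_sum_imp_sums[of "\<lambda>j. sum f (level j)"] sums_nonneg_imp_has_sum[of "\<lambda>j. sum f (level j)"]
    by (auto simp: nonneg sum_nonneg)
  finally show ?thesis .
qed

section \<open>Convergence of the exponential series\<close>

lemma exp_term_has_sum:
  assumes "\<And>n. 0 \<le> c n" "\<And>i. 0 \<le> \<theta> $ i"
  shows "(exp_term \<theta> c x has_sum s) UNIV \<longleftrightarrow> (\<lambda>j. (dir_op \<theta> ^^ j) c x / fact j) sums s"
  using has_sum_levels[of "exp_term \<theta> c x" s] exp_term_nonneg[of c \<theta> x, OF assms]
  by (simp add: level_sum_eq)

text \<open>Log-concavity makes successive ratios nonincreasing, so the first ratio bounds them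
  all.\<close>

lemma log_concave_seq_bound:
  fixes b :: "nat \<Rightarrow> real"
  assumes nonneg: "\<And>j. 0 \<le> b j" and lc: "\<And>j. b j * b (Suc (Suc j)) \<le> (b (Suc j))\<^sup>2"
    and zero: "\<And>j. b j = 0 \<Longrightarrow> b (Suc j) = 0"
  shows "\<exists>r\<ge>0. \<forall>j. b j \<le> b 0 * r ^ j"
proof (intro exI conjI allI)
  \<comment> \<open>If \<open>b 0 = 0\<close>, division gives \<open>r = 0\<close>, and
    \<open>zero\<close> gives \<open>b 1 = 0\<close>, so the induction on ratios still
    starts.\<close>
  define r where "r = b 1 / b 0"
  show r: "0 \<le> r" using nonneg by (simp add: r_def)
  have ratio: "b (Suc j) \<le> r * b j" for j
  proof (induction j)
    case 0
    then show ?case using zero[of 0] by (cases "b 0 = 0") (auto simp: r_def)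
  next
    case (Suc j)
    show ?case
    proof (cases "b j = 0")
      case True
      then show ?thesis using zero by simp
    next
      case False
      then have bj: "0 < b j" using nonneg[of j] by simp
      have "b j * b (Suc (Suc j)) \<le> b (Suc j) * b (Suc j)" using lc[of j] by (simp add: power2_eq_square)
      also have "\<dots> \<le> b (Suc j) * (r * b j)" using Suc nonneg by (intro mult_left_mono)
      also have "\<dots> = b j * (r * b (Suc j))" by simp
      finally show ?thesis using bj by simp
    qed
  qed
  show "b j \<le> b 0 * r ^ j" for j
  proof (induction j)
    case (Suc j)
    have "b (Suc j) \<le> r * b j" by (rule ratio)
    also have "\<dots> \<le> r * (b 0 * r ^ j)" using Suc r by (rule mult_left_mono)
    finally show ?case by (simp add: mult_ac)
  qed simp
qed

text \<open>The Lorentzian condition for the j-th power of \<open>dir_op \<theta>\<close>, taken in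
  the direction \<theta> itself, makes the numerators log-concave in j. They grow at most
  geometrically, and the factorials win.\<close>

lemma lorentzian_exp_sums:
  assumes c: "lorentzian c" and \<theta>: "\<And>i. 0 \<le> \<theta> $ i"
  shows "summable (\<lambda>j. (dir_op \<theta> ^^ j) c x / fact j)"
proof -
  define b where "b j = (dir_op \<theta> ^^ j) c x" for j
  note L = lorentzian_dir_op_funpow[OF c \<theta>]
  have "0 \<le> b j" for j unfolding b_def by (rule lorentzianD(1)[OF L])
  moreover have "b j * b (Suc (Suc j)) \<le> (b (Suc j))\<^sup>2" for j
    using lorentzianD(3)[OF L[of j], of x "homog 0 \<theta>"] by (simp add: b_def dir_op_def)
  moreover have "b (Suc j) = 0" if "b j = 0" for j
    using lorentzian_zero[OF L[of j], of x] that by (simp add: b_def dir_op_eq)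
  ultimately obtain r where r: "0 \<le> r" "\<And>j. b j \<le> b 0 * r ^ j"
    using log_concave_seq_bound[of b] by blast
  have "summable (\<lambda>j. b 0 * (inverse (fact j) * r ^ j))"
    by (intro summable_mult summable_exp)
  then show ?thesis
  proof (rule summable_comparison_test[rotated], intro exI allI impI)
    fix j
    have "0 \<le> b j" unfolding b_def by (rule lorentzianD(1)[OF L])
    then show "norm ((dir_op \<theta> ^^ j) c x / fact j) \<le> b 0 * (inverse (fact j) * r ^ j)"
      using r(2)[of j] by (simp add: b_def[symmetric] field_simps)
  qed
qed

lemma lorentzian_exp_term:
  assumes "lorentzian c" and "\<And>i. 0 \<le> \<theta> $ i"
  shows "(exp_term \<theta> c x has_sum exp_op \<theta> c x) UNIV"
    "(\<lambda>j. (dir_op \<theta> ^^ j) c x / fact j) sums exp_op \<theta> c x"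
proof -
  note iff = exp_term_has_sum[of c \<theta> x, OF lorentzianD(1)[OF assms(1)] assms(2)]
  have "exp_term \<theta> c x summable_on UNIV"
    using lorentzian_exp_sums[OF assms, of x] iff unfolding summable_on_def summable_def by blast
  then show "(exp_term \<theta> c x has_sum exp_op \<theta> c x) UNIV" unfolding exp_op_def by (rule has_sum_infsum)
  then show "(\<lambda>j. (dir_op \<theta> ^^ j) c x / fact j) sums exp_op \<theta> c x"
    unfolding iff .
qed

section \<open>The exponential as a limit of binomial powers\<close>

lemma dir_op_sum: "dir_op v (\<lambda>x. \<Sum>j\<in>S. r j * f j x) x = (\<Sum>j\<in>S. r j * dir_op v (f j) x)"
  unfolding dir_op_eq sum_distrib_left by (subst sum.swap) (simp add: mult_ac)

lemma binomial_shift_op: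
  "(shift_op (homog 1 (s *\<^sub>R \<theta>)) ^^ m) c x
    = (\<Sum>j\<le>m. real (m choose j) * s ^ j * (dir_op \<theta> ^^ j) c x)"
proof (induction m arbitrary: x)
  case (Suc m)
  define b where "b j = (dir_op \<theta> ^^ j) c x" for j
  have dir: "dir_op (s *\<^sub>R \<theta>) f x = s * dir_op \<theta> f x" for f x
    by (simp add: dir_op_eq sum_distrib_left mult_ac)
  have "dir_op \<theta> (\<lambda>x. \<Sum>j\<le>m. real (m choose j) * s ^ j * (dir_op \<theta> ^^ j) c x) x
      = (\<Sum>j\<le>m. real (m choose j) * s ^ j * b (Suc j))"
    by (simp add: b_def dir_op_sum)
  then have "(shift_op (homog 1 (s *\<^sub>R \<theta>)) ^^ Suc m) c x
      = (\<Sum>j\<le>m. real (m choose j) * s ^ j * b j) + s * (\<Sum>j\<le>m. real (m choose j) * s ^ j * b (Suc j))"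
    unfolding funpow.simps o_apply shift_op_homog dir ext[OF Suc] b_def by simp
  also have "\<dots> = (\<Sum>j\<le>Suc m. real (Suc m choose j) * s ^ j * b j)"
  proof -
    have "(\<Sum>j\<le>Suc m. real (Suc m choose j) * s ^ j * b j)
        = b 0 + (\<Sum>j\<le>m. real (Suc m choose Suc j) * s ^ Suc j * b (Suc j))"
      by (simp add: sum.atMost_Suc_shift del: sum.atMost_Suc binomial_Suc_Suc)
    also have "\<dots> = (b 0 + (\<Sum>j\<le>m. real (m choose Suc j) * s ^ Suc j * b (Suc j)))
        + (\<Sum>j\<le>m. real (m choose j) * s ^ Suc j * b (Suc j))"
      by (simp add: algebra_simps sum.distrib)
    also have "b 0 + (\<Sum>j\<le>m. real (m choose Suc j) * s ^ Suc j * b (Suc j))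
        = (\<Sum>j\<le>Suc m. real (m choose j) * s ^ j * b j)"
      by (simp add: sum.atMost_Suc_shift del: sum.atMost_Suc)
    finally show ?thesis by (simp add: sum_distrib_left mult_ac)
  qed
  finally show ?case by (simp add: b_def)
qed simp

lemma binomial_over_power_le: "real (m choose j) / real m ^ j \<le> 1 / fact j"
proof (cases "j \<le> m")
  case True
  have "fact j * (m choose j) = fact m div fact (m - j)"
    using binomial_fact_lemma[OF True] by (metis div_mult_self1_is_m fact_gt_zero mult.assoc mult.commute)
  then have "fact j * (m choose j) \<le> m ^ j" using fact_div_fact_le_pow[OF True] by simp
  then have "real (fact j * (m choose j)) \<le> real (m ^ j)" by (simp only: of_nat_le_iff)
  then show ?thesis by (cases "m = 0") (use True in \<open>auto simp: field_simps\<close>)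
qed (simp add: binomial_eq_0)

lemma binomial_over_power_tendsto: "(\<lambda>m. real (m choose j) / real m ^ j) \<longlonglongrightarrow> 1 / fact j"
proof -
  have "(\<lambda>m. (\<Prod>i = 0..<j. (real m - real i) / real m) / fact j) \<longlonglongrightarrow> (\<Prod>i = 0..<j. 1) / fact j"
  proof (intro tendsto_divide tendsto_prod tendsto_const)
    fix i
    have "(\<lambda>m. 1 - real i * inverse (real m)) \<longlonglongrightarrow> 1 - real i * 0"
      by (intro tendsto_intros lim_inverse_n)
    moreover have "\<forall>\<^sub>F m in sequentially. 1 - real i * inverse (real m) = (real m - real i) / real m"
      using eventually_gt_at_top[of 0] by eventually_elim (simp add: field_simps)
    ultimately show "(\<lambda>m. (real m - real i) / real m) \<longlonglongrightarrow> 1"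
      using Lim_transform_eventually by fastforce
  qed simp
  then show ?thesis
    by (simp add: binomial_gbinomial gbinomial_prod_rev prod_dividef mult.commute)
qed

text \<open>After binomial expansion the terms converge one by one and are dominated by those of the
  exponential series, so Tannery's theorem exchanges limit and sum.\<close>

lemma shift_op_tendsto_exp_op:
  assumes c: "lorentzian c" and \<theta>: "\<And>i. 0 \<le> \<theta> $ i"
  shows "(\<lambda>m. (shift_op (homog 1 ((1 / real m) *\<^sub>R \<theta>)) ^^ m) c x) \<longlonglongrightarrow> exp_op \<theta> c x"
proof -
  define b where "b j = (dir_op \<theta> ^^ j) c x" for j
  have b0: "0 \<le> b j" for j
    unfolding b_def by (rule lorentzianD(1)[OF lorentzian_dir_op_funpow[OF c \<theta>]])
  define a where "a j m = real (m choose j) / real m ^ j * b j" for j m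
  have "(\<lambda>m. \<Sum>j. a j m) \<longlonglongrightarrow> (\<Sum>j. b j / fact j)"
  proof (rule tannerys_theorem[THEN conjunct2, THEN conjunct2])
    show "(\<lambda>m. a j m) \<longlonglongrightarrow> b j / fact j" for j
      using tendsto_mult_right[OF binomial_over_power_tendsto[of j], of "b j"] by (simp add: a_def)
    have "norm (a j m) \<le> b j / fact j" for j m
      using mult_right_mono[OF binomial_over_power_le[of m j] b0[of j]] b0[of j] by (simp add: a_def)
    then show "\<forall>\<^sub>F (j, m) in sequentially \<times>\<^sub>F sequentially. norm (a j m) \<le> b j / fact j"
      by (intro always_eventually) auto
    show "summable (\<lambda>j. b j / fact j)" unfolding b_def by (rule lorentzian_exp_sums[OF c \<theta>])
  qed simp
  moreover have "(\<Sum>j. b j / fact j) = exp_op \<theta> c x"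
    using lorentzian_exp_term(2)[OF c \<theta>, of x] by (simp add: b_def sums_iff)
  moreover have "(\<Sum>j. a j m) = (shift_op (homog 1 ((1 / real m) *\<^sub>R \<theta>)) ^^ m) c x" for m
    unfolding binomial_shift_op
    by (subst suminf_finite[of "{..m}"]) (auto simp: a_def b_def power_divide binomial_eq_0)
  ultimately show ?thesis by simp
qed

text \<open>The summand at \<open>k = 0\<close> is \<open>c x\<close>, a lower bound; if
  \<open>c x = 0\<close>, all entries above \<open>x\<close> vanish as well.\<close>

lemma lorentzian_exp_op_pos_iff:
  assumes c: "lorentzian c" and \<theta>: "\<And>i. 0 \<le> \<theta> $ i"
  shows "0 \<le> exp_op \<theta> c x" "0 < exp_op \<theta> c x \<longleftrightarrow> 0 < c x"
proof -
  have "c x = sum (exp_term \<theta> c x) {0}" by (simp add: exp_term_def)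
  also have "\<dots> \<le> exp_op \<theta> c x" unfolding exp_op_def
    using lorentzian_exp_term(1)[OF c \<theta>] exp_term_nonneg[OF lorentzianD(1)[OF c] \<theta>]
    by (intro finite_sum_le_infsum) (auto simp: summable_on_def)
  finally have le: "c x \<le> exp_op \<theta> c x" .
  then show "0 \<le> exp_op \<theta> c x" using lorentzianD(1)[OF c, of x] by simp
  have "exp_op \<theta> c x = 0" if "c x = 0"
    unfolding exp_op_def exp_term_def by (simp add: lorentzian_zero[OF c that])
  then show "0 < exp_op \<theta> c x \<longleftrightarrow> 0 < c x"
    using le lorentzianD(1)[OF c, of x] by fastforce
qed

text \<open>The quadratic inequality survives the pointwise limit of the binomial powers. Strict
  positivity need not survive limits, so the support condition comes from \<open>c\<close> and
  \<open>exp_op \<theta> c\<close> having the same support.\<close>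

lemma lorentzian_exp_op:
  assumes c: "lorentzian c" and \<theta>: "\<And>i. 0 \<le> \<theta> $ i"
  shows "lorentzian (exp_op \<theta> c)"
  unfolding lorentzian_def
proof (intro conjI allI impI)
  fix n U
  note pos = lorentzian_exp_op_pos_iff[OF c \<theta>]
  show "0 \<le> exp_op \<theta> c n" by (rule pos)
  show "0 < exp_op \<theta> c m" if "m \<le> n" "0 < exp_op \<theta> c n" for m n
    using that lorentzianD(2)[OF c] unfolding pos(2) by blast
  define G where "G m = (shift_op (homog 1 ((1 / real m) *\<^sub>R \<theta>)) ^^ m) c" for m
  have G: "(\<lambda>m. G m x) \<longlonglongrightarrow> exp_op \<theta> c x" for x
    unfolding G_def by (rule shift_op_tendsto_exp_op[OF c \<theta>])
  have lim: "(\<lambda>m. shift_op U (F m) x) \<longlonglongrightarrow> shift_op U f x"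
    if "\<And>x. (\<lambda>m. F m x) \<longlonglongrightarrow> f x" for F :: "nat \<Rightarrow> nat ^ 'a \<Rightarrow> real" and f x
    unfolding shift_op_def by (intro tendsto_intros that)
  have "lorentzian (G m)" for m
    unfolding G_def by (intro lorentzian_funpow c homog_nonneg) (auto simp: \<theta>)
  then have "G m n * shift_op U (shift_op U (G m)) n \<le> (shift_op U (G m) n)\<^sup>2" for m
    by (rule lorentzianD(3))
  then show "exp_op \<theta> c n * shift_op U (shift_op U (exp_op \<theta> c)) n \<le> (shift_op U (exp_op \<theta> c) n)\<^sup>2"
    by (intro LIMSEQ_le[OF tendsto_mult[OF G lim[OF lim[OF G]]] tendsto_power[OF lim[OF G]]]) auto
qed

section \<open>Log-concavity in the direction\<close>

text \<open>The power rule: shift operators commute, so the product rule gives m equal terms. At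
  \<open>m = 0\<close> the truncated \<open>m - 1\<close> is masked by the factor
  \<open>real m\<close>.\<close>

lemma shift_op_funpow_has_derivative:
  "((\<lambda>s. (shift_op (\<lambda>a. W a + s * U a) ^^ m) c x) has_real_derivative
    real m * shift_op U ((shift_op (\<lambda>a. W a + s * U a) ^^ (m - 1)) c) x) (at s)"
proof (induction m arbitrary: x)
  case (Suc m)
  let ?V = "\<lambda>s a. W a + s * U a"
  have "((\<lambda>s. \<Sum>a\<in>UNIV. ?V s a * (shift_op (?V s) ^^ m) c (x + opt_unit_vec a)) has_real_derivative
      (\<Sum>a\<in>UNIV. U a * (shift_op (?V s) ^^ m) c (x + opt_unit_vec a)
        + real m * shift_op U ((shift_op (?V s) ^^ (m - 1)) c) (x + opt_unit_vec a) * ?V s a)) (at s)"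
    by (intro DERIV_sum DERIV_mult' derivative_eq_intros DERIV_cong[OF DERIV_mult[OF _ Suc]]) auto
  also have "(\<Sum>a\<in>UNIV. U a * (shift_op (?V s) ^^ m) c (x + opt_unit_vec a)
        + real m * shift_op U ((shift_op (?V s) ^^ (m - 1)) c) (x + opt_unit_vec a) * ?V s a)
      = shift_op U ((shift_op (?V s) ^^ m) c) x
        + real m * shift_op (?V s) (shift_op U ((shift_op (?V s) ^^ (m - 1)) c)) x"
    unfolding shift_op_def[of U "(shift_op (?V s) ^^ m) c"]
      shift_op_def[of "?V s" "shift_op U ((shift_op (?V s) ^^ (m - 1)) c)"]
    by (simp only: sum.distrib sum_distrib_left mult_ac)
  also have "\<dots> = real (Suc m) * shift_op U ((shift_op (?V s) ^^ (Suc m - 1)) c) x"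
    unfolding shift_op_commute[of "?V s"] by (cases m) (simp_all add: algebra_simps)
  finally show ?case
    by (simp add: shift_op_def[of "?V _" "(shift_op _ ^^ m) c"])
qed simp

lemma shift_op_pos:
  assumes "lorentzian c" "\<And>a. 0 \<le> W a" "0 < W None" "0 < c x"
  shows "0 < shift_op W c x"
  unfolding shift_op_def using assms lorentzianD(1)[OF assms(1)]
  by (intro sum_pos2[of _ None]) auto

lemma shift_op_funpow_pos:
  assumes "lorentzian c" "\<And>a. 0 \<le> W a" "0 < W None" "0 < c x"
  shows "0 < (shift_op W ^^ m) c x"
  by (induction m) (auto simp: assms intro!: shift_op_pos lorentzian_funpow)

text \<open>With moving coefficients V and velocity U, the value and its derivatives come from the
  operators \<open>V^m\<close>, \<open>m U V^(m-1)\<close> and \<open>m (m-1) U^2 V^(m-2)\<close>.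
  Reverse Cauchy-Schwarz for the Lorentzian array \<open>V^(m-2) c\<close> bounds value times second
  derivative by the squared first derivative.\<close>

lemma ln_shift_op_funpow_concave:
  assumes c: "lorentzian c" "0 < c x"
    and W: "\<And>a. 0 \<le> W a" "0 < W None" and W': "\<And>a. 0 \<le> W' a" "0 < W' None"
  shows "concave_on {0..1} (\<lambda>s. ln ((shift_op (\<lambda>a. W a + s * (W' a - W a)) ^^ m) c x))"
proof -
  define U where "U a = W' a - W a" for a
  define V where "V s a = W a + s * U a" for s a
  define \<phi>0 where "\<phi>0 s = (shift_op (V s) ^^ m) c x" for s
  define \<phi>1 where "\<phi>1 s = real m * shift_op U ((shift_op (V s) ^^ (m - 1)) c) x" for s
  define \<phi>2 where
    "\<phi>2 s = real m * (real (m - 1) * shift_op U (shift_op U ((shift_op (V s) ^^ (m - 1 - 1)) c)) x)" for s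
  have V: "0 \<le> V s a" "0 < V s None" if "s \<in> {0..1}" for s a
  proof -
    have eq: "V s a = (1 - s) * W a + s * W' a" for a by (simp add: V_def U_def algebra_simps)
    show "0 \<le> V s a" unfolding eq using that W W' by (auto intro!: add_nonneg_nonneg)
    show "0 < V s None" unfolding eq using that W(2) W'(2)
      by (cases "s = 0") (auto intro!: add_nonneg_pos)
  qed
  have pos: "0 < \<phi>0 s" if "s \<in> {0..1}" for s
    unfolding \<phi>0_def by (intro shift_op_funpow_pos c V that)
  have D1: "(\<phi>0 has_real_derivative \<phi>1 s) (at s)" for s
    unfolding \<phi>0_def \<phi>1_def V_def by (rule shift_op_funpow_has_derivative)
  have D2: "(\<phi>1 has_real_derivative \<phi>2 s) (at s)" for s
  proof -
    have "((\<lambda>s. \<Sum>a\<in>UNIV. U a * (shift_op (V s) ^^ (m - 1)) c (x + opt_unit_vec a)) has_real_derivative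
      (\<Sum>a\<in>UNIV. U a * (real (m - 1) * shift_op U ((shift_op (V s) ^^ (m - 1 - 1)) c) (x + opt_unit_vec a)))) (at s)"
      unfolding V_def by (intro DERIV_sum DERIV_cmult shift_op_funpow_has_derivative)
    then show ?thesis
      unfolding \<phi>1_def \<phi>2_def
      by (intro DERIV_cmult) (simp add: shift_op_def[of U "(shift_op _ ^^ _) c"]
        shift_op_def[of U "shift_op U _"] sum_distrib_left mult_ac)
  qed
  have ineq: "\<phi>2 s * \<phi>0 s \<le> (\<phi>1 s)\<^sup>2" if s: "s \<in> {0..1}" for s
  proof (cases "m \<le> 1")
    case True
    then have "\<phi>2 s = 0" by (auto simp: \<phi>2_def)
    then show ?thesis by simp
  next
    case False
    then obtain p where m: "m = Suc (Suc p)" by (intro that[of "m - 2"]) simp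
    define g where "g = (shift_op (V s) ^^ p) c"
    have g: "lorentzian g" unfolding g_def by (intro lorentzian_funpow c V s)
    have "0 \<le> shift_op (V s) (shift_op (V s) g) x"
      by (intro shift_op_nonneg V s lorentzianD(1)[OF g])
    from lorentzian_reverse_Cauchy_Schwarz[OF g this, of U]
    have *: "shift_op (V s) (shift_op (V s) g) x * shift_op U (shift_op U g) x
        \<le> (shift_op U (shift_op (V s) g) x)\<^sup>2"
      by (simp only: shift_op_commute[of U "V s"])
    have "\<phi>2 s * \<phi>0 s = real m * real (m - 1) *
        (shift_op (V s) (shift_op (V s) g) x * shift_op U (shift_op U g) x)"
      by (simp add: \<phi>2_def \<phi>0_def m g_def)
    also have "\<dots> \<le> real m * real (m - 1) * (shift_op U (shift_op (V s) g) x)\<^sup>2"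
      by (intro mult_left_mono *) auto
    also have "\<dots> \<le> (real m)\<^sup>2 * (shift_op U (shift_op (V s) g) x)\<^sup>2"
      by (intro mult_right_mono) (auto simp: power2_eq_square intro!: mult_left_mono)
    also have "\<dots> = (\<phi>1 s)\<^sup>2" by (simp add: \<phi>1_def m g_def power_mult_distrib)
    finally show ?thesis .
  qed
  have "concave_on {0..1} (\<lambda>s. ln (\<phi>0 s))"
  proof (rule f''_le0_imp_concave)
    show "convex {0..1::real}" by simp
    fix s :: real assume s: "s \<in> {0..1}"
    show "((\<lambda>s. ln (\<phi>0 s)) has_real_derivative \<phi>1 s / \<phi>0 s) (at s)"
      using pos[OF s] by (auto intro!: derivative_eq_intros D1)
    show "((\<lambda>s. \<phi>1 s / \<phi>0 s) has_real_derivative (\<phi>2 s * \<phi>0 s - \<phi>1 s * \<phi>1 s) / (\<phi>0 s * \<phi>0 s)) (at s)"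
      using pos[OF s] by (intro DERIV_divide D1 D2) auto
    show "(\<phi>2 s * \<phi>0 s - \<phi>1 s * \<phi>1 s) / (\<phi>0 s * \<phi>0 s) \<le> 0"
      using ineq[OF s] pos[OF s] by (intro divide_nonpos_pos) (auto simp: power2_eq_square)
  qed
  then show ?thesis unfolding \<phi>0_def V_def U_def .
qed

lemma convex_pos_orthant: "convex pos_orthant"
  unfolding convex_def
proof (intro ballI allI impI)
  fix x y :: "real ^ 'a" and u v :: real
  assume x: "x \<in> pos_orthant" and y: "y \<in> pos_orthant" and uv: "0 \<le> u" "0 \<le> v" "u + v = 1"
  have "0 < u * x $ i + v * y $ i" for i
  proof (cases "u = 0")
    case False
    then show ?thesis using x y uv by (intro add_pos_nonneg) (auto simp: pos_orthant_def less_imp_le)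
  qed (use y uv in \<open>simp add: pos_orthant_def\<close>)
  then show "u *\<^sub>R x + v *\<^sub>R y \<in> pos_orthant" by (simp add: pos_orthant_def)
qed

text \<open>The approximants are log-concave because \<theta> enters their homogenised coefficients
  affinely, the entry at \<open>None\<close> staying 1. The logarithm is continuous at the positive
  limit, so concavity passes to it.\<close>

lemma exp_op_log_concave:
  assumes c: "lorentzian c" "0 < c x"
  shows "log_concave_on pos_orthant (\<lambda>\<theta>. exp_op \<theta> c x)"
proof -
  have pos: "0 < exp_op \<theta> c x" if "\<theta> \<in> pos_orthant" for \<theta>
    using lorentzian_exp_op_pos_iff(2)[OF c(1)] c(2) that by (simp add: pos_orthant_def less_imp_le)
  define G where "G m \<theta> = (shift_op (homog 1 ((1 / real m) *\<^sub>R \<theta>)) ^^ m) c x" for m \<theta>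
  have G: "(\<lambda>m. ln (G m \<theta>)) \<longlonglongrightarrow> ln (exp_op \<theta> c x)" if "\<theta> \<in> pos_orthant" for \<theta>
    unfolding G_def using pos[OF that] that
    by (intro tendsto_ln shift_op_tendsto_exp_op c) (auto simp: pos_orthant_def less_imp_le)
  have "u * ln (exp_op \<theta> c x) + v * ln (exp_op \<theta>' c x) \<le> ln (exp_op (u *\<^sub>R \<theta> + v *\<^sub>R \<theta>') c x)"
    if \<theta>: "\<theta> \<in> pos_orthant" "\<theta>' \<in> pos_orthant" and uv: "0 \<le> u" "0 \<le> v" "u + v = 1" for \<theta> \<theta>' u v
  proof (rule LIMSEQ_le)
    show "(\<lambda>m. u * ln (G m \<theta>) + v * ln (G m \<theta>')) \<longlonglongrightarrow> u * ln (exp_op \<theta> c x) + v * ln (exp_op \<theta>' c x)"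
      by (intro tendsto_intros G \<theta>)
    show "(\<lambda>m. ln (G m (u *\<^sub>R \<theta> + v *\<^sub>R \<theta>'))) \<longlonglongrightarrow> ln (exp_op (u *\<^sub>R \<theta> + v *\<^sub>R \<theta>') c x)"
      using convex_pos_orthant \<theta> uv by (intro G) (auto simp: convex_def)
    have "u * ln (G m \<theta>) + v * ln (G m \<theta>') \<le> ln (G m (u *\<^sub>R \<theta> + v *\<^sub>R \<theta>'))" for m
    proof -
      let ?W = "homog 1 ((1 / real m) *\<^sub>R \<theta>)" and ?W' = "homog 1 ((1 / real m) *\<^sub>R \<theta>')"
      let ?\<phi> = "\<lambda>s. ln ((shift_op (\<lambda>a. ?W a + s * (?W' a - ?W a)) ^^ m) c x)"
      have "concave_on {0..1} ?\<phi>" using \<theta>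
        by (intro ln_shift_op_funpow_concave c homog_nonneg) (auto simp: pos_orthant_def less_imp_le)
      then have "(1 - v) * ?\<phi> 0 + v * ?\<phi> 1 \<le> ?\<phi> ((1 - v) *\<^sub>R 0 + v *\<^sub>R 1)"
        by (rule concave_onD) (use uv in auto)
      moreover have "(\<lambda>a. ?W a + v * (?W' a - ?W a)) = homog 1 ((1 / real m) *\<^sub>R (u *\<^sub>R \<theta> + v *\<^sub>R \<theta>'))"
      proof
        fix a
        have u: "u = 1 - v" using uv by simp
        show "?W a + v * (?W' a - ?W a) = homog 1 ((1 / real m) *\<^sub>R (u *\<^sub>R \<theta> + v *\<^sub>R \<theta>')) a"
          by (cases a) (simp_all add: u algebra_simps add_divide_distrib diff_divide_distrib)
      qed
      moreover have "u = 1 - v" using uv by simp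
      ultimately show ?thesis by (simp add: G_def)
    qed
    then show "\<exists>N. \<forall>m\<ge>N. u * ln (G m \<theta>) + v * ln (G m \<theta>') \<le> ln (G m (u *\<^sub>R \<theta> + v *\<^sub>R \<theta>'))" by blast
  qed
  then show ?thesis using pos convex_pos_orthant by (simp add: log_concave_on_def concave_on_iff)
qed

section \<open>Second-order expansion along a ray at the origin\<close>

lemma dir_op_scaleR_funpow: "(dir_op (s *\<^sub>R \<theta>) ^^ j) c x = s ^ j * (dir_op \<theta> ^^ j) c x"
proof (induction j arbitrary: x)
  case (Suc j)
  then show ?case by (simp add: dir_op_eq sum_distrib_left mult_ac)
qed simp

text \<open>Along the ray of \<theta> the function is a power series in s, and convergence at s = 1
  gives it on the unit interval. The converses apply this before the array is known to be
  Lorentzian.\<close>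

lemma exp_op_taylor:
  assumes c: "\<And>n. 0 \<le> c n" and \<theta>: "\<And>i. 0 \<le> \<theta> $ i" and summ: "exp_term \<theta> c x summable_on UNIV"
  obtains R where "(R \<longlongrightarrow> dir_op \<theta> (dir_op \<theta> c) x / 2) (at_right 0)"
    "\<And>s. 0 < s \<Longrightarrow> s < 1 \<Longrightarrow> exp_op (s *\<^sub>R \<theta>) c x = c x + s * dir_op \<theta> c x + s\<^sup>2 * R s"
proof -
  define \<beta> where "\<beta> j = (dir_op \<theta> ^^ j) c x / fact j" for j
  \<comment> \<open>The power series without its first two terms, divided by
    \<open>s\<^sup>2\<close>.\<close>
  define R where "R s = (\<Sum>j. \<beta> (Suc (Suc j)) * s ^ j)" for s
  obtain S where "(exp_term \<theta> c x has_sum S) UNIV" using summ by (auto simp: summable_on_def)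
  then have "\<beta> sums S" unfolding \<beta>_def by (subst (asm) exp_term_has_sum[OF c \<theta>])
  then have "summable \<beta>" by (rule sums_summable)
  then have sm: "summable (\<lambda>j. \<beta> j * s ^ j)" if "\<bar>s\<bar> < 1" for s
    using powser_inside[of \<beta> 1 s] that by simp
  have sm1: "summable (\<lambda>j. \<beta> (Suc j) * s ^ j)" if "\<bar>s\<bar> < 1" for s
    by (rule powser_split_head(3)[OF sm[OF that]])
  have sm2: "summable (\<lambda>j. \<beta> (Suc (Suc j)) * s ^ j)" if "\<bar>s\<bar> < 1" for s
    by (rule powser_split_head(3)[OF sm1[OF that]])
  have "(R \<longlongrightarrow> \<beta> 2) (at 0)"
    unfolding R_def
    using powser_limit_0[of 1 "\<lambda>j. \<beta> (Suc (Suc j))" "\<lambda>s. \<Sum>j. \<beta> (Suc (Suc j)) * s ^ j"] sm2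
    by (simp add: summable_sums numeral_2_eq_2)
  then have lim: "(R \<longlongrightarrow> dir_op \<theta> (dir_op \<theta> c) x / 2) (at_right 0)"
    unfolding \<beta>_def by (simp add: numeral_2_eq_2 filterlim_at_split)
  have "exp_op (s *\<^sub>R \<theta>) c x = c x + s * dir_op \<theta> c x + s\<^sup>2 * R s" if s: "0 < s" "s < 1" for s
  proof -
    have s': "\<bar>s\<bar> < 1" using s by simp
    have "(\<lambda>j. (dir_op (s *\<^sub>R \<theta>) ^^ j) c x / fact j) sums (\<Sum>j. \<beta> j * s ^ j)"
      using sm[OF s'] by (simp add: dir_op_scaleR_funpow \<beta>_def summable_sums mult.commute)
    then have "(exp_term (s *\<^sub>R \<theta>) c x has_sum (\<Sum>j. \<beta> j * s ^ j)) UNIV"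
      using exp_term_has_sum[of c "s *\<^sub>R \<theta>"] c \<theta> s by simp
    then have "exp_op (s *\<^sub>R \<theta>) c x = (\<Sum>j. \<beta> j * s ^ j)" by (simp add: exp_op_def infsumI)
    also have "\<dots> = \<beta> 0 + (\<Sum>j. \<beta> (Suc j) * s ^ j) * s" using powser_split_head(1)[OF sm[OF s']] .
    also have "(\<Sum>j. \<beta> (Suc j) * s ^ j) = \<beta> 1 + R s * s"
      using powser_split_head(1)[OF sm1[OF s']] by (simp add: R_def)
    finally show ?thesis by (simp add: \<beta>_def algebra_simps power2_eq_square)
  qed
  with lim show thesis by (rule that)
qed

section \<open>Ultra-log-concavity and spectral independence\<close>

lemma dir_op_dir_op:
  "dir_op u (dir_op v c) n = (\<Sum>i\<in>UNIV. \<Sum>j\<in>UNIV. u $ i * v $ j * c (n + unit_vec i + unit_vec j))"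
  by (simp add: dir_op_eq sum_distrib_left mult_ac)

lemma dir_op_quadratic_form:
  "(dir_op u c n)\<^sup>2 - c n * dir_op u (dir_op u c) n = (\<Sum>i\<in>UNIV. \<Sum>j\<in>UNIV.
    u $ i * c (n + unit_vec i) * (u $ j * c (n + unit_vec j)) - c n * (u $ i * u $ j * c (n + unit_vec i + unit_vec j)))"
proof -
  have "(dir_op u c n)\<^sup>2 = (\<Sum>i\<in>UNIV. \<Sum>j\<in>UNIV. u $ i * c (n + unit_vec i) * (u $ j * c (n + unit_vec j)))"
    unfolding dir_op_eq power2_eq_square by (rule sum_product)
  then show ?thesis by (simp only: dir_op_dir_op sum_distrib_left sum_subtractf)
qed

text \<open>A homogenising part t adds the same amount,
  \<open>t^2 (c n)^2 + 2 t (c n) (dir_op u c n)\<close>, to both sides.\<close>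

lemma lorentzian_iff_dir_op:
  "lorentzian c \<longleftrightarrow> (\<forall>n. 0 \<le> c n) \<and> (\<forall>m n. m \<le> n \<longrightarrow> 0 < c n \<longrightarrow> 0 < c m) \<and>
    (\<forall>n u. c n * dir_op u (dir_op u c) n \<le> (dir_op u c n)\<^sup>2)"
proof -
  have *: "(\<forall>U. c n * shift_op U (shift_op U c) n \<le> (shift_op U c n)\<^sup>2)
      \<longleftrightarrow> (\<forall>u. c n * dir_op u (dir_op u c) n \<le> (dir_op u c n)\<^sup>2)" for n
  proof (intro iffI allI)
    fix u assume all: "\<forall>U. c n * shift_op U (shift_op U c) n \<le> (shift_op U c n)\<^sup>2"
    show "c n * dir_op u (dir_op u c) n \<le> (dir_op u c n)\<^sup>2"
      using spec[OF all, of "homog 0 u"] by (simp only: dir_op_def)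
  next
    fix U :: "'a option \<Rightarrow> real" assume dir: "\<forall>u. c n * dir_op u (dir_op u c) n \<le> (dir_op u c n)\<^sup>2"
    define t u where "t = U None" and "u = (\<chi> i. U (Some i))"
    have U: "U = homog t u"
    proof
      show "U a = homog t u a" for a by (cases a) (simp_all add: t_def u_def)
    qed
    have lin: "dir_op u (\<lambda>n. t * c n + dir_op u c n) n = t * dir_op u c n + dir_op u (dir_op u c) n"
      unfolding dir_op_def[of u] shift_op_add shift_op_scale ..
    have shift: "shift_op U c = (\<lambda>n. t * c n + dir_op u c n)"
      unfolding U by (rule ext) (rule shift_op_homog)
    have "shift_op U (shift_op U c) n
        = t * (t * c n + dir_op u c n) + (t * dir_op u c n + dir_op u (dir_op u c) n)"
      unfolding shift unfolding U shift_op_homog lin ..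
    then show "c n * shift_op U (shift_op U c) n \<le> (shift_op U c n)\<^sup>2"
      using dir[rule_format, of u] by (simp add: shift power2_eq_square algebra_simps)
  qed
  show ?thesis by (simp only: lorentzian_def *)
qed

lemma ulc_coeff_nonneg: "0 \<le> ulc_coeff \<mu> n"
  by (simp add: ulc_coeff_def less_imp_le)

lemma ulc_coeff_pos_iff: "0 < ulc_coeff \<mu> n \<longleftrightarrow> n \<in> set_pmf \<mu>"
  by (simp add: ulc_coeff_def zero_less_mult_iff pmf_positive_iff)

lemma ulc_coeff_eq_0_iff: "ulc_coeff \<mu> n = 0 \<longleftrightarrow> n \<notin> set_pmf \<mu>"
  using ulc_coeff_pos_iff[of \<mu> n] ulc_coeff_nonneg[of \<mu> n] by fastforce

lemma downward_closedD: "downward_closed S \<Longrightarrow> n + m \<in> S \<Longrightarrow> n \<in> S"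
  unfolding downward_closed_def using le_add_vec by blast

text \<open>The test vector \<open>a (n + unit_vec i) * u $ i\<close> clears the denominators of the
  ULC matrix. Indices outside \<open>ulc_index\<close> can be added because downward closure makes
  their entries 0.\<close>

lemma ulc_quadratic_form:
  assumes dc: "downward_closed (set_pmf \<mu>)"
  defines "a \<equiv> ulc_coeff \<mu>"
  shows "(\<Sum>i\<in>ulc_index \<mu> n. \<Sum>j\<in>ulc_index \<mu> n. (a (n + unit_vec i) * u $ i) *
      (1 - a n * a (n + unit_vec i + unit_vec j) / (a (n + unit_vec i) * a (n + unit_vec j))) *
      (a (n + unit_vec j) * u $ j))
    = (dir_op u a n)\<^sup>2 - a n * dir_op u (dir_op u a) n"
proof -
  let ?I = "ulc_index \<mu> n"
  define g where "g i j = u $ i * a (n + unit_vec i) * (u $ j * a (n + unit_vec j))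
      - a n * (u $ i * u $ j * a (n + unit_vec i + unit_vec j))" for i j
  have zero: "a (n + unit_vec i) = 0" "a (n + unit_vec i + unit_vec j) = 0"
      "a (n + unit_vec j + unit_vec i) = 0" if "i \<notin> ?I" for i j
    using that downward_closedD[OF dc, of "n + unit_vec i" "unit_vec j"]
    by (auto simp: a_def ulc_coeff_eq_0_iff ulc_index_def add_ac)
  have "(\<Sum>i\<in>?I. \<Sum>j\<in>?I. (a (n + unit_vec i) * u $ i) *
      (1 - a n * a (n + unit_vec i + unit_vec j) / (a (n + unit_vec i) * a (n + unit_vec j))) *
      (a (n + unit_vec j) * u $ j)) = (\<Sum>i\<in>?I. \<Sum>j\<in>?I. g i j)"
  proof (intro sum.cong refl)
    fix i j assume "i \<in> ?I" "j \<in> ?I"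
    then have "a (n + unit_vec i) \<noteq> 0" "a (n + unit_vec j) \<noteq> 0"
      by (simp_all add: a_def ulc_coeff_eq_0_iff ulc_index_def)
    then show "(a (n + unit_vec i) * u $ i) *
      (1 - a n * a (n + unit_vec i + unit_vec j) / (a (n + unit_vec i) * a (n + unit_vec j))) *
      (a (n + unit_vec j) * u $ j) = g i j"
      by (simp add: g_def field_simps)
  qed
  also have "\<dots> = (\<Sum>i\<in>?I. \<Sum>j\<in>UNIV. g i j)"
    by (intro sum.cong refl sum.mono_neutral_left) (auto simp: g_def zero)
  also have "\<dots> = (\<Sum>i\<in>UNIV. \<Sum>j\<in>UNIV. g i j)"
    by (intro sum.mono_neutral_left) (auto simp: g_def zero)
  also have "\<dots> = (dir_op u a n)\<^sup>2 - a n * dir_op u (dir_op u a) n"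
    unfolding dir_op_quadratic_form g_def ..
  finally show ?thesis .
qed

lemma ULC_iff_lorentzian:
  assumes dc: "downward_closed (set_pmf \<mu>)"
  shows "ULC \<mu> \<longleftrightarrow> lorentzian (ulc_coeff \<mu>)"
proof -
  define a where "a = ulc_coeff \<mu>"
  define M where "M n i j = 1 - a n * a (n + unit_vec i + unit_vec j) / (a (n + unit_vec i) * a (n + unit_vec j))"
    for n i j
  note quad = ulc_quadratic_form[OF dc, folded a_def, folded M_def]
  have psd: "psd_on (ulc_index \<mu> n) (M n) \<longleftrightarrow> (\<forall>u. a n * dir_op u (dir_op u a) n \<le> (dir_op u a n)\<^sup>2)" for n
  proof
    assume "psd_on (ulc_index \<mu> n) (M n)"
    then have v: "\<forall>v. 0 \<le> (\<Sum>i\<in>ulc_index \<mu> n. \<Sum>j\<in>ulc_index \<mu> n. v i * M n i j * v j)"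
      by (simp add: psd_on_def)
    have "0 \<le> (dir_op u a n)\<^sup>2 - a n * dir_op u (dir_op u a) n" for u
      using spec[OF v, of "\<lambda>i. a (n + unit_vec i) * u $ i"] unfolding quad .
    then show "\<forall>u. a n * dir_op u (dir_op u a) n \<le> (dir_op u a n)\<^sup>2" by (simp add: algebra_simps)
  next
    assume *: "\<forall>u. a n * dir_op u (dir_op u a) n \<le> (dir_op u a n)\<^sup>2"
    show "psd_on (ulc_index \<mu> n) (M n)" unfolding psd_on_def
    proof (intro conjI ballI allI)
      show "M n i j = M n j i" for i j by (simp add: M_def add_ac mult_ac)
      fix v :: "'a \<Rightarrow> real"
      define u where "u = (\<chi> i. v i / a (n + unit_vec i))"
      have v: "v i = a (n + unit_vec i) * u $ i" if "i \<in> ulc_index \<mu> n" for i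
        using that by (simp add: u_def a_def ulc_index_def ulc_coeff_eq_0_iff)
      have "(\<Sum>i\<in>ulc_index \<mu> n. \<Sum>j\<in>ulc_index \<mu> n. v i * M n i j * v j)
          = (dir_op u a n)\<^sup>2 - a n * dir_op u (dir_op u a) n"
        unfolding quad[symmetric] by (intro sum.cong refl) (simp add: v)
      then show "0 \<le> (\<Sum>i\<in>ulc_index \<mu> n. \<Sum>j\<in>ulc_index \<mu> n. v i * M n i j * v j)"
        using * by simp
    qed
  qed
  have supp: "m \<le> n \<longrightarrow> 0 < a n \<longrightarrow> 0 < a m" for m n
    using dc by (auto simp: a_def ulc_coeff_pos_iff downward_closed_def)
  have off: "a n * dir_op u (dir_op u a) n \<le> (dir_op u a n)\<^sup>2" if "n \<notin> set_pmf \<mu>" for n u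
    using that by (simp add: a_def ulc_coeff_eq_0_iff[THEN iffD2])
  have "ULC \<mu> \<longleftrightarrow> (\<forall>n\<in>set_pmf \<mu>. psd_on (ulc_index \<mu> n) (M n))"
    unfolding ULC_def M_def a_def using dc by simp
  also have "\<dots> \<longleftrightarrow> (\<forall>n u. a n * dir_op u (dir_op u a) n \<le> (dir_op u a n)\<^sup>2)"
    unfolding psd using off by blast
  also have "\<dots> \<longleftrightarrow> lorentzian a"
    unfolding lorentzian_iff_dir_op using supp by (simp add: a_def ulc_coeff_nonneg)
  finally show ?thesis by (simp add: a_def)
qed

section \<open>Moments of tilted pinnings\<close>

lemma expectation_has_sum:
  fixes f :: "'a::countable \<Rightarrow> real"
  assumes "((\<lambda>k. pmf \<rho> k * f k) has_sum s) UNIV"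
  shows "integrable (measure_pmf \<rho>) f" "measure_pmf.expectation \<rho> f = s"
proof -
  have int: "integrable (count_space UNIV) (\<lambda>k. pmf \<rho> k * f k)"
    using has_sum_imp_summable[OF assms] summable_on_iff_abs_summable_on_real
    by (metis abs_summable_equivalent abs_summable_on_def)
  then show "integrable (measure_pmf \<rho>) f"
    by (subst measure_pmf_eq_density, subst integrable_density) auto
  have "measure_pmf.expectation \<rho> f = (\<integral>k. pmf \<rho> k * f k \<partial>count_space UNIV)"
    by (subst measure_pmf_eq_density, subst integral_density) auto
  also have "\<dots> = infsum (\<lambda>k. pmf \<rho> k * f k) UNIV"
    using int infsetsum_infsum[of "\<lambda>k. pmf \<rho> k * f k" UNIV] by (simp add: abs_summable_on_def infsetsum_def)
  finally show "measure_pmf.expectation \<rho> f = s" using infsumI[OF assms] by simp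
qed

text \<open>The binomials multiply to \<open>(x + k)! / (x! k!)\<close>, so up to \<open>x!\<close>
  the pinning lists the Taylor coefficients at 0 of the x-th derivative of the generating
  function.\<close>

lemma pinning_weight_eq: "pinning_weight \<mu> x k = exp_term 1 (ulc_coeff \<mu>) x k / mfact x"
proof -
  have "(\<Prod>i\<in>UNIV. real ((x $ i + k $ i) choose (x $ i)))
      = (\<Prod>i\<in>UNIV. fact ((x + k) $ i) / (fact (x $ i) * fact (k $ i)))"
    by (intro prod.cong refl) (simp add: binomial_fact)
  then show ?thesis
    by (simp add: pinning_weight_def exp_term_def ulc_coeff_def mfact_def prod_dividef prod.distrib mpower_def mult_ac)
qed

lemma exp_term_eq_one: "exp_term \<theta> c x k = exp_term 1 c x k * mpower \<theta> k"
  by (simp add: exp_term_def mpower_def[of 1])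

text \<open>A shift in coordinate \<open>i\<close> absorbs the factor \<open>k $ i\<close>, and
  terms with \<open>k $ i = 0\<close> contribute nothing. The free function \<open>f\<close> lets
  the lemma be applied twice for second moments.\<close>

lemma exp_term_moment:
  assumes "((\<lambda>k. f (k + unit_vec i) * exp_term \<theta> c (x + unit_vec i) k) has_sum S) UNIV"
  shows "((\<lambda>k. f k * real (k $ i) * exp_term \<theta> c x k) has_sum (\<theta> $ i * S)) UNIV"
proof -
  have "((\<lambda>k. f (k + unit_vec i) * real ((k + unit_vec i) $ i) * exp_term \<theta> c x (k + unit_vec i))
      has_sum (\<theta> $ i * S)) UNIV"
    using has_sum_cmult_right[OF assms, of "\<theta> $ i"]
    unfolding mult.assoc exp_term_add_unit_vec by (simp only: mult.left_commute)
  then have "((\<lambda>k. f k * real (k $ i) * exp_term \<theta> c x k) has_sum (\<theta> $ i * S)) {k. k $ i \<noteq> 0}"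
    by (subst (asm) has_sum_reindex_bij_betw[OF bij_betw_add_unit_vec])
  then show ?thesis
    by (rule has_sum_cong_neutral[THEN iffD1, rotated -1]) auto
qed

lemma exp_op_pos:
  assumes c: "\<And>n. 0 \<le> c n" and \<theta>: "\<And>i. 0 \<le> \<theta> $ i"
    and "exp_term \<theta> c x summable_on UNIV" and "0 < c x"
  shows "0 < exp_op \<theta> c x"
proof -
  have "c x = sum (exp_term \<theta> c x) {0}" by (simp add: exp_term_def)
  also have "\<dots> \<le> exp_op \<theta> c x" unfolding exp_op_def
    using exp_term_nonneg[of c \<theta> x, OF c \<theta>] assms(3) by (intro finite_sum_le_infsum) auto
  finally show ?thesis using assms(4) by simp
qed

text \<open>The tilted pinning has masses \<open>T x k / F x\<close>, so first shifts of
  \<open>F\<close> give its mean and second shifts its second moments, up to a diagonal term equal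
  to the mean. That term cancels against the diagonal matrix of means, which is why the constant 1
  matches the quadratic condition for \<open>F\<close>.\<close>

lemma tilted_pinning_iff:
  assumes x: "x \<in> set_pmf \<mu>" and \<theta>: "\<theta> \<in> pos_orthant"
    and S1: "\<And>y. exp_term 1 (ulc_coeff \<mu>) y summable_on UNIV"
    and S\<theta>: "\<And>y. exp_term \<theta> (ulc_coeff \<mu>) y summable_on UNIV"
  defines "F \<equiv> exp_op \<theta> (ulc_coeff \<mu>)"
  shows "tilted_pinning_spectrally_independent 1 \<theta> \<mu> x
    \<longleftrightarrow> (\<forall>u. F x * dir_op u (dir_op u F) x \<le> (dir_op u F x)\<^sup>2)"
proof -
  define a where "a = ulc_coeff \<mu>"
  define T where "T y k = exp_term \<theta> a y k" for y k
  have T_eq: "T = exp_term \<theta> a" by (simp add: T_def fun_eq_iff)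
  define F1 where "F1 = exp_op 1 a x"
  have a0: "0 \<le> a n" for n by (simp add: a_def ulc_coeff_nonneg)
  have ax: "0 < a x" using x by (simp add: a_def ulc_coeff_pos_iff)
  have \<theta>0: "0 < \<theta> $ i" for i using \<theta> by (simp add: pos_orthant_def)
  have F1: "0 < F1" unfolding F1_def
    using S1 ax a0 by (intro exp_op_pos) (auto simp: a_def)
  have Fx: "0 < F x" unfolding F_def a_def[symmetric]
    using S\<theta> ax a0 by (intro exp_op_pos) (auto simp: a_def \<theta>0 less_imp_le)
  have T: "(T y has_sum F y) UNIV" for y
    unfolding T_def F_def exp_op_def a_def using S\<theta>[of y] by (simp add: has_sum_infsum)
  have pw: "pinning_weight \<mu> x = (\<lambda>k. exp_term 1 a x k / mfact x)"
    by (rule ext) (simp add: pinning_weight_eq a_def)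
  have "(exp_term 1 a x has_sum F1) UNIV"
    unfolding F1_def exp_op_def a_def using S1[of x] by (simp add: has_sum_infsum)
  from has_sum_cmult_left[OF this, of "inverse (mfact x)"]
  have Z: "(pinning_weight \<mu> x has_sum (F1 / mfact x)) UNIV" by (simp add: pw divide_inverse)
  have pd: "pinning_defined \<mu> x"
    using x has_sum_imp_summable[OF Z] by (simp add: pinning_defined_def)
  have pmf_pin: "pmf (pinning \<mu> x) k = exp_term 1 a x k / F1" for k
    unfolding pmf_pinning[OF pd] infsumI[OF Z] by (simp add: pw)
  have "((\<lambda>k. pmf (pinning \<mu> x) k * mpower \<theta> k) has_sum (F x / F1)) UNIV"
    using has_sum_cmult_left[OF T[of x], of "inverse F1"]
    by (simp add: pmf_pin T_def exp_term_eq_one[of \<theta>] divide_inverse mult_ac)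
  note tilt_exp = expectation_has_sum[OF this]
  have td: "tilt_defined \<theta> (pinning \<mu> x)" using \<theta> tilt_exp(1) by (simp add: tilt_defined_def)
  define \<rho> where "\<rho> = tilt \<theta> (pinning \<mu> x)"
  have pmf_\<rho>: "pmf \<rho> k = T x k / F x" for k
    unfolding \<rho>_def pmf_tilt[OF td] tilt_exp(2) using F1 by (simp add: pmf_pin T_def exp_term_eq_one[of \<theta>])
  have \<rho>_sum: "((\<lambda>k. pmf \<rho> k * f k) has_sum (S / F x)) UNIV" if "((\<lambda>k. f k * T x k) has_sum S) UNIV" for f S
    using has_sum_cmult_left[OF that, of "inverse (F x)"] by (simp add: pmf_\<rho> divide_inverse mult_ac)
  have m1: "((\<lambda>k. real (k $ i) * T x k) has_sum (\<theta> $ i * F (x + unit_vec i))) UNIV" for i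
    using exp_term_moment[of "\<lambda>_. 1" i \<theta> a x "F (x + unit_vec i)"] T[of "x + unit_vec i"]
    by (simp add: T_eq)
  define \<delta> where "\<delta> i j = (if i = j then 1 else 0 :: real)" for i j :: 'a
  define m where "m i = \<theta> $ i * F (x + unit_vec i) / F x" for i
  \<comment> \<open>The \<delta> term arises because the first shift raises coordinate
    \<open>j\<close> by one exactly when \<open>i = j\<close>.\<close>
  have m2: "((\<lambda>k. real (k $ j) * real (k $ i) * T x k) has_sum
      (\<theta> $ i * (\<theta> $ j * F (x + unit_vec i + unit_vec j) + \<delta> i j * F (x + unit_vec i)))) UNIV" for i j
    unfolding T_def
  proof (rule exp_term_moment)
    have "((\<lambda>k. real (k $ j) * T (x + unit_vec i) k + \<delta> i j * T (x + unit_vec i) k) has_sum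
      (\<theta> $ j * F (x + unit_vec i + unit_vec j) + \<delta> i j * F (x + unit_vec i))) UNIV"
      using exp_term_moment[of "\<lambda>_. 1" j \<theta> a "x + unit_vec i" "F (x + unit_vec i + unit_vec j)"]
        T[of "x + unit_vec i + unit_vec j"]
      by (intro has_sum_add has_sum_cmult_right T) (simp add: T_eq)
    moreover have "real ((k + unit_vec i) $ j) = real (k $ j) + \<delta> i j" for k
      by (simp add: unit_vec_nth \<delta>_def)
    ultimately show "((\<lambda>k. real ((k + unit_vec i) $ j) * exp_term \<theta> a (x + unit_vec i) k) has_sum
      (\<theta> $ j * F (x + unit_vec i + unit_vec j) + \<delta> i j * F (x + unit_vec i))) UNIV"
      by (simp only: T_eq distrib_right)
  qed
  have mean: "mean \<rho> i = m i" for i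
    unfolding mean_def m_def by (rule expectation_has_sum(2)[OF \<rho>_sum[OF m1]])
  have fsm: "finite_second_moments \<rho>" unfolding finite_second_moments_def
  proof
    show "integrable (measure_pmf \<rho>) (\<lambda>n. (real (n $ i))\<^sup>2)" for i
      using expectation_has_sum(1)[OF \<rho>_sum[OF m2[of i i]]] by (simp add: power2_eq_square)
  qed
  have cov: "cov \<rho> i j = \<theta> $ i * \<theta> $ j * F (x + unit_vec i + unit_vec j) / F x + \<delta> i j * m i - m i * m j" for i j
  proof -
    have "((\<lambda>k. real (k $ j) * real (k $ i) * T x k + ((- m j) * (real (k $ i) * T x k)
        + ((- m i) * (real (k $ j) * T x k) + m i * m j * T x k))) has_sum
      (\<theta> $ i * (\<theta> $ j * F (x + unit_vec i + unit_vec j) + \<delta> i j * F (x + unit_vec i))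
        + ((- m j) * (\<theta> $ i * F (x + unit_vec i)) + ((- m i) * (\<theta> $ j * F (x + unit_vec j)) + m i * m j * F x)))) UNIV"
      by (intro has_sum_add has_sum_cmult_right m1 m2 T)
    also have "(\<lambda>k. real (k $ j) * real (k $ i) * T x k + ((- m j) * (real (k $ i) * T x k)
        + ((- m i) * (real (k $ j) * T x k) + m i * m j * T x k)))
      = (\<lambda>k. ((real (k $ i) - m i) * (real (k $ j) - m j)) * T x k)"
      by (rule ext) (simp add: algebra_simps)
    finally have "cov \<rho> i j = (\<theta> $ i * (\<theta> $ j * F (x + unit_vec i + unit_vec j) + \<delta> i j * F (x + unit_vec i))
        + ((- m j) * (\<theta> $ i * F (x + unit_vec i)) + ((- m i) * (\<theta> $ j * F (x + unit_vec j)) + m i * m j * F x))) / F x"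
      unfolding cov_def mean by (intro expectation_has_sum(2) \<rho>_sum)
    also have "\<dots> = \<theta> $ i * \<theta> $ j * F (x + unit_vec i + unit_vec j) / F x + \<delta> i j * m i
        - m j * m i - m i * m j + m i * m j"
      using Fx by (simp add: m_def field_simps)
    finally show ?thesis by simp
  qed
  \<comment> \<open>Rescaling coordinates by \<theta> is a congruence, invertible because \<theta>
    is positive.\<close>
  have quad: "(\<Sum>i\<in>UNIV. \<Sum>j\<in>UNIV. v i * (1 * (if i = j then mean \<rho> i else 0) - cov \<rho> i j) * v j)
      = ((dir_op u F x)\<^sup>2 - F x * dir_op u (dir_op u F) x) / (F x)\<^sup>2"
    if u: "\<And>i. u $ i = \<theta> $ i * v i" for u v
  proof -
    have "v i * (1 * (if i = j then mean \<rho> i else 0) - cov \<rho> i j) * v j =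
        (u $ i * F (x + unit_vec i) * (u $ j * F (x + unit_vec j))
          - F x * (u $ i * u $ j * F (x + unit_vec i + unit_vec j))) / (F x)\<^sup>2" for i j
    proof -
      have eq: "1 * (if i = j then mean \<rho> i else 0) - cov \<rho> i j
          = m i * m j - \<theta> $ i * \<theta> $ j * F (x + unit_vec i + unit_vec j) / F x"
        by (simp add: cov mean \<delta>_def)
      show ?thesis unfolding eq using Fx by (simp add: u m_def field_simps power2_eq_square)
    qed
    then show ?thesis by (simp only: dir_op_quadratic_form sum_divide_distrib)
  qed
  have "spectrally_independent 1 \<rho> \<longleftrightarrow> (\<forall>u. F x * dir_op u (dir_op u F) x \<le> (dir_op u F x)\<^sup>2)"
  proof
    assume si: "spectrally_independent 1 \<rho>"
    show "\<forall>u. F x * dir_op u (dir_op u F) x \<le> (dir_op u F x)\<^sup>2"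
    proof
      fix u
      have u: "u $ i = \<theta> $ i * (u $ i / \<theta> $ i)" for i using \<theta>0[of i] by simp
      have "\<forall>v. 0 \<le> (\<Sum>i\<in>UNIV. \<Sum>j\<in>UNIV. v i * (1 * (if i = j then mean \<rho> i else 0) - cov \<rho> i j) * v j)"
        using si unfolding spectrally_independent_def loewner_le_def psd_on_def by (rule conjunct2)
      from spec[OF this, of "\<lambda>i. u $ i / \<theta> $ i"]
      have "0 \<le> ((dir_op u F x)\<^sup>2 - F x * dir_op u (dir_op u F) x) / (F x)\<^sup>2"
        by (subst (asm) quad[of u, OF u])
      then show "F x * dir_op u (dir_op u F) x \<le> (dir_op u F x)\<^sup>2"
        using Fx by (simp add: zero_le_divide_iff)
    qed
  next
    assume *: "\<forall>u. F x * dir_op u (dir_op u F) x \<le> (dir_op u F x)\<^sup>2"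
    have "0 \<le> (\<Sum>i\<in>UNIV. \<Sum>j\<in>UNIV. v i * (1 * (if i = j then mean \<rho> i else 0) - cov \<rho> i j) * v j)" for v
      by (subst quad[of "\<chi> i. \<theta> $ i * v i"]) (use * in auto)
    moreover have "cov \<rho> i j = cov \<rho> j i" for i j by (simp add: cov_def mult.commute)
    ultimately show "spectrally_independent 1 \<rho>"
      unfolding spectrally_independent_def loewner_le_def psd_on_def by auto
  qed
  then show ?thesis
    using pd td fsm by (simp add: tilted_pinning_spectrally_independent_def \<rho>_def)
qed

section \<open>Log-concave generating functions\<close>

text \<open>Factorial weights turn formal differentiation into a plain index shift, so derivatives
  of the series become \<open>dir_op\<close> on the array of derivatives at 0.\<close>

lemma mfact_foldr_dir_partial:
  "(\<lambda>n. mfact n * foldr dir_partial vs f n) = foldr dir_op vs (\<lambda>n. mfact n * f n)"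
proof (induction vs)
  case (Cons v vs)
  have step: "mfact n * dir_partial v g n = dir_op v (\<lambda>n. mfact n * g n) n" for g n
    by (simp add: dir_partial_def partial_def dir_op_eq mfact_add_unit_vec sum_distrib_left algebra_simps)
  show ?case by (simp add: step flip: Cons)
qed simp

lemma lorentzian_foldr_dir_op:
  "lorentzian c \<Longrightarrow> (\<And>v i. v \<in> set vs \<Longrightarrow> 0 \<le> v $ i) \<Longrightarrow> lorentzian (foldr dir_op vs c)"
  by (induction vs) (auto intro!: lorentzian_dir_op)

lemma exp_term_mfact: "exp_term \<theta> (\<lambda>n. mfact n * f n) 0 = (\<lambda>n. f n * mpower \<theta> n)"
  by (simp add: exp_term_def fun_eq_iff)

text \<open>One nonzero coefficient makes the constant coefficient positive by downward closure; the
  value of the series is then \<open>exp_op\<close> at index 0, which is log-concave.\<close>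

lemma lorentzian_imp_zero_or_log_concave:
  assumes c: "lorentzian (\<lambda>n. mfact n * f n)"
  shows "zero_or_log_concave f"
proof (cases "f = (\<lambda>_. 0)")
  case False
  then obtain n where "f n \<noteq> 0" by auto
  then have "0 < mfact n * f n"
    using lorentzianD(1)[OF c, of n] mfact_pos[of n] by (simp add: zero_le_mult_iff zero_less_mult_iff)
  then have f0: "0 < mfact 0 * f 0"
    using lorentzianD(2)[OF c, of 0 n] by (simp add: less_eq_vec_def)
  have "converges_at f \<theta>" if "\<theta> \<in> pos_orthant" for \<theta>
    using lorentzian_exp_term(1)[OF c, of \<theta> 0] that
    unfolding converges_at_def exp_term_mfact pos_orthant_def
    by (auto simp: less_imp_le intro: has_sum_imp_summable)
  moreover have "mfps_value f = (\<lambda>\<theta>. exp_op \<theta> (\<lambda>n. mfact n * f n) 0)"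
    by (simp add: fun_eq_iff mfps_value_def exp_op_def exp_term_mfact)
  ultimately show ?thesis
    using exp_op_log_concave[OF c f0] by (simp add: zero_or_log_concave_def)
qed (simp add: zero_or_log_concave_def)

lemma mixed_partial_as_dir_partials:
  "\<exists>vs. (\<forall>v\<in>set vs. \<forall>i. 0 \<le> v $ i) \<and> foldr dir_partial vs f = mixed_partial x f"
proof (induction "\<Sum>i\<in>UNIV. x $ i" arbitrary: x)
  case 0
  then have "x = 0" by (auto simp: vec_eq_iff)
  then have "foldr dir_partial [] f = mixed_partial x f"
    by (simp add: mixed_partial_eq)
  then show ?case by (intro exI[of _ "[]"]) simp
next
  case (Suc m)
  have "\<exists>i. x $ i \<noteq> 0"
  proof (rule ccontr)
    assume "\<not> ?thesis"
    then show False using Suc(2) by simp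
  qed
  then obtain i where i: "x $ i \<noteq> 0" ..
  define y where "y = x - unit_vec i"
  have x: "x = y + unit_vec i" using i by (auto simp: y_def vec_eq_iff unit_vec_nth)
  have "(\<Sum>i\<in>UNIV. x $ i) = Suc (\<Sum>i\<in>UNIV. y $ i)" by (simp add: x unit_vec_nth sum.distrib)
  with Suc(2) have "m = (\<Sum>i\<in>UNIV. y $ i)" by simp
  from Suc(1)[OF this] obtain vs
    where vs: "\<forall>v\<in>set vs. \<forall>i. 0 \<le> v $ i" "foldr dir_partial vs f = mixed_partial y f" by blast
  have "dir_partial (axis i 1) g n = partial i g n" for g n
    by (simp add: dir_partial_def axis_def if_distrib[of "\<lambda>x. x * _"] cong: if_cong)
  moreover have "partial i (mixed_partial y f) n = mixed_partial x f n" for n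
  proof -
    have "n + unit_vec i + y = n + x" by (simp add: x add_ac)
    moreover have "real (n $ i + 1) \<noteq> 0" by linarith
    ultimately show ?thesis
      by (simp add: partial_def mixed_partial_eq mfact_add_unit_vec add.commute)
  qed
  ultimately have "foldr dir_partial (axis i 1 # vs) f = mixed_partial x f"
    by (simp add: fun_eq_iff vs(2))
  moreover have "\<forall>v\<in>set (axis i 1 # vs). \<forall>i. (0::real) \<le> v $ i" using vs(1) by (simp add: axis_def)
  ultimately show ?case by blast
qed

text \<open>
  With \<open>G \<theta> = exp_op \<theta> c x\<close>, compare the coefficients of \<open>s\<^sup>2\<close> in \<open>G (s q)\<^sup>2 \<ge> G (s (q + u)) G (s (q - u))\<close> as \<open>s \<rightarrow> 0\<close>, where
  \<open>q\<close> is chosen so that all three points are in the positive orthant.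
\<close>

lemma log_concave_imp_quadratic:
  fixes c :: "nat ^ 'd::finite \<Rightarrow> real"
  assumes c: "\<And>n. 0 \<le> c n"
    and summ: "\<And>\<theta>. \<theta> \<in> pos_orthant \<Longrightarrow> exp_term \<theta> c x summable_on UNIV"
    and lc: "log_concave_on pos_orthant (\<lambda>\<theta>. exp_op \<theta> c x)"
  shows "c x * dir_op u (dir_op u c) x \<le> (dir_op u c x)\<^sup>2"
proof -
  define q :: "real ^ 'd" where "q = (\<chi> i. \<bar>u $ i\<bar> + 1)"
  have pos: "q \<in> pos_orthant" "q + u \<in> pos_orthant" "q - u \<in> pos_orthant"
    by (auto simp: pos_orthant_def q_def)
  have taylor: "\<exists>R. (R \<longlongrightarrow> dir_op \<theta> (dir_op \<theta> c) x / 2) (at_right 0) \<and>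
    (\<forall>s. 0 < s \<longrightarrow> s < 1 \<longrightarrow> exp_op (s *\<^sub>R \<theta>) c x = c x + s * dir_op \<theta> c x + s\<^sup>2 * R s)"
    if "\<theta> \<in> pos_orthant" for \<theta>
    by (rule exp_op_taylor[of c \<theta> x, OF c _ summ[OF that]])
       (use that in \<open>auto simp: pos_orthant_def less_imp_le\<close>)
  obtain R where R: "(R \<longlongrightarrow> dir_op q (dir_op q c) x / 2) (at_right 0)"
    "\<And>s. 0 < s \<Longrightarrow> s < 1 \<Longrightarrow> exp_op (s *\<^sub>R q) c x = c x + s * dir_op q c x + s\<^sup>2 * R s"
    using taylor[OF pos(1)] by blast
  obtain Rp where Rp: "(Rp \<longlongrightarrow> dir_op (q + u) (dir_op (q + u) c) x / 2) (at_right 0)"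
    "\<And>s. 0 < s \<Longrightarrow> s < 1 \<Longrightarrow> exp_op (s *\<^sub>R (q + u)) c x = c x + s * dir_op (q + u) c x + s\<^sup>2 * Rp s"
    using taylor[OF pos(2)] by blast
  obtain Rm where Rm: "(Rm \<longlongrightarrow> dir_op (q - u) (dir_op (q - u) c) x / 2) (at_right 0)"
    "\<And>s. 0 < s \<Longrightarrow> s < 1 \<Longrightarrow> exp_op (s *\<^sub>R (q - u)) c x = c x + s * dir_op (q - u) c x + s\<^sup>2 * Rm s"
    using taylor[OF pos(3)] by blast
  define A \<beta> \<gamma> where "A = c x" and "\<beta> = dir_op q c x" and "\<gamma> = dir_op u c x"
  have lin: "dir_op (q + u) f y = dir_op q f y + dir_op u f y"
    "dir_op (q - u) f y = dir_op q f y - dir_op u f y" for f y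
    by (simp_all add: dir_op_eq algebra_simps sum.distrib sum_subtractf)
  have lin2: "dir_op (q + u) (dir_op (q + u) c) x
      = dir_op q (dir_op q c) x + 2 * dir_op q (dir_op u c) x + dir_op u (dir_op u c) x"
    "dir_op (q - u) (dir_op (q - u) c) x
      = dir_op q (dir_op q c) x - 2 * dir_op q (dir_op u c) x + dir_op u (dir_op u c) x"
  proof -
    have "dir_op u (dir_op q c) x = dir_op q (dir_op u c) x"
      unfolding dir_op_def by (simp only: shift_op_commute[of "homog 0 u" "homog 0 q"])
    moreover have "dir_op v (dir_op (q + u) c) x = dir_op v (dir_op q c) x + dir_op v (dir_op u c) x"
      "dir_op v (dir_op (q - u) c) x = dir_op v (dir_op q c) x - dir_op v (dir_op u c) x" for v
      unfolding dir_op_eq[of v] by (simp_all add: lin algebra_simps sum.distrib sum_subtractf)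
    ultimately show "dir_op (q + u) (dir_op (q + u) c) x
      = dir_op q (dir_op q c) x + 2 * dir_op q (dir_op u c) x + dir_op u (dir_op u c) x"
      "dir_op (q - u) (dir_op (q - u) c) x
      = dir_op q (dir_op q c) x - 2 * dir_op q (dir_op u c) x + dir_op u (dir_op u c) x"
      by (simp_all add: lin)
  qed
  \<comment> \<open>The difference of the two sides divided by \<open>s\<^sup>2\<close>; the terms
    of order 0 and 1 in s cancel.\<close>
  define P where "P s = (\<gamma>\<^sup>2 + A * (2 * R s - Rp s - Rm s))
    + s * (2 * \<beta> * R s - (\<beta> + \<gamma>) * Rm s - (\<beta> - \<gamma>) * Rp s) + s\<^sup>2 * ((R s)\<^sup>2 - Rp s * Rm s)" for s
  have P_nonneg: "0 \<le> P s" if s: "0 < s" "s < 1" for s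
  proof -
    let ?G = "\<lambda>\<theta>. exp_op \<theta> c x"
    have spos: "s *\<^sub>R q \<in> pos_orthant" "s *\<^sub>R (q + u) \<in> pos_orthant" "s *\<^sub>R (q - u) \<in> pos_orthant"
      using pos s by (auto simp: pos_orthant_def simp del: scaleR_add_right)
    have G: "0 < ?G (s *\<^sub>R q)" "0 < ?G (s *\<^sub>R (q + u))" "0 < ?G (s *\<^sub>R (q - u))"
      using lc spos by (auto simp: log_concave_on_def)
    have mid: "(1 - 1 / 2) *\<^sub>R (s *\<^sub>R (q + u)) + (1 / 2) *\<^sub>R (s *\<^sub>R (q - u)) = s *\<^sub>R q"
      by (simp add: vec_eq_iff field_simps)
    have "concave_on pos_orthant (\<lambda>\<theta>. ln (?G \<theta>))" using lc by (simp add: log_concave_on_def)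
    from concave_onD[OF this, of "1 / 2" "s *\<^sub>R (q + u)" "s *\<^sub>R (q - u)"] spos
    have "ln (?G (s *\<^sub>R (q + u))) + ln (?G (s *\<^sub>R (q - u))) \<le> 2 * ln (?G (s *\<^sub>R q))"
      unfolding mid by simp
    then have "ln (?G (s *\<^sub>R (q + u)) * ?G (s *\<^sub>R (q - u))) \<le> ln ((?G (s *\<^sub>R q))\<^sup>2)"
      using G by (simp add: ln_mult ln_realpow)
    then have "?G (s *\<^sub>R (q + u)) * ?G (s *\<^sub>R (q - u)) \<le> (?G (s *\<^sub>R q))\<^sup>2"
      using G by (subst (asm) ln_le_cancel_iff) auto
    moreover have "(?G (s *\<^sub>R q))\<^sup>2 - ?G (s *\<^sub>R (q + u)) * ?G (s *\<^sub>R (q - u)) = s\<^sup>2 * P s"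
      unfolding R(2)[OF s] Rp(2)[OF s] Rm(2)[OF s] lin A_def[symmetric] \<beta>_def[symmetric] \<gamma>_def[symmetric] P_def
      by (simp add: power2_eq_square algebra_simps)
    ultimately have "0 \<le> s\<^sup>2 * P s" by simp
    then show ?thesis using s by (simp add: zero_le_mult_iff)
  qed
  have "(P \<longlongrightarrow> (\<gamma>\<^sup>2 + A * (2 * (dir_op q (dir_op q c) x / 2) - dir_op (q + u) (dir_op (q + u) c) x / 2
      - dir_op (q - u) (dir_op (q - u) c) x / 2))
    + 0 * (2 * \<beta> * (dir_op q (dir_op q c) x / 2) - (\<beta> + \<gamma>) * (dir_op (q - u) (dir_op (q - u) c) x / 2)
      - (\<beta> - \<gamma>) * (dir_op (q + u) (dir_op (q + u) c) x / 2))
    + 0\<^sup>2 * ((dir_op q (dir_op q c) x / 2)\<^sup>2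
      - dir_op (q + u) (dir_op (q + u) c) x / 2 * (dir_op (q - u) (dir_op (q - u) c) x / 2))) (at_right 0)"
    unfolding P_def by (intro tendsto_intros R(1) Rp(1) Rm(1))
  then have "0 \<le> (\<gamma>\<^sup>2 + A * (2 * (dir_op q (dir_op q c) x / 2) - dir_op (q + u) (dir_op (q + u) c) x / 2
      - dir_op (q - u) (dir_op (q - u) c) x / 2))
    + 0 * (2 * \<beta> * (dir_op q (dir_op q c) x / 2) - (\<beta> + \<gamma>) * (dir_op (q - u) (dir_op (q - u) c) x / 2)
      - (\<beta> - \<gamma>) * (dir_op (q + u) (dir_op (q + u) c) x / 2))
    + 0\<^sup>2 * ((dir_op q (dir_op q c) x / 2)\<^sup>2
      - dir_op (q + u) (dir_op (q + u) c) x / 2 * (dir_op (q - u) (dir_op (q - u) c) x / 2))"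
    by (rule tendsto_lowerbound) (auto intro!: eventually_at_rightI[of 0 1] P_nonneg)
  \<comment> \<open>All second-order terms involving \<open>q\<close> cancel, leaving
    \<open>\<gamma>\<^sup>2 - A * dir_op u (dir_op u c) x\<close>.\<close>
  then show ?thesis unfolding lin2 by (simp add: A_def \<gamma>_def field_simps)
qed

section \<open>Implications between the conditions\<close>

lemma ulc_coeff_gen_fun: "(\<lambda>n. mfact n * gen_fun \<mu> n) = ulc_coeff \<mu>"
  by (simp add: fun_eq_iff gen_fun_def ulc_coeff_def)

lemma lorentzian_imp_completely_log_concave:
  assumes "lorentzian (ulc_coeff \<mu>)"
  shows "completely_log_concave (gen_fun \<mu>)"
  unfolding completely_log_concave_def
proof (intro allI impI)
  fix vs :: "(real ^ 'a) list" assume "\<forall>v\<in>set vs. \<forall>i. 0 \<le> v $ i"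
  then show "zero_or_log_concave (foldr dir_partial vs (gen_fun \<mu>))"
    using assms
    by (intro lorentzian_imp_zero_or_log_concave)
       (simp add: mfact_foldr_dir_partial ulc_coeff_gen_fun lorentzian_foldr_dir_op)
qed

lemma completely_imp_strongly_log_concave:
  "completely_log_concave f \<Longrightarrow> strongly_log_concave f"
  unfolding strongly_log_concave_def
proof
  fix x
  assume "completely_log_concave f"
  moreover obtain vs where "\<forall>v\<in>set vs. \<forall>i. 0 \<le> v $ i" "foldr dir_partial vs f = mixed_partial x f"
    using mixed_partial_as_dir_partials by blast
  ultimately show "zero_or_log_concave (mixed_partial x f)"
    unfolding completely_log_concave_def by metis
qed

text \<open>Off the support the left side is 0, so the converses can work at support points.\<close>

lemma lorentzian_ulc_coeffI:
  assumes dc: "downward_closed (set_pmf \<mu>)"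
    and quad: "\<And>x u. x \<in> set_pmf \<mu> \<Longrightarrow>
      ulc_coeff \<mu> x * dir_op u (dir_op u (ulc_coeff \<mu>)) x \<le> (dir_op u (ulc_coeff \<mu>) x)\<^sup>2"
  shows "lorentzian (ulc_coeff \<mu>)"
  unfolding lorentzian_iff_dir_op
proof (intro conjI allI impI)
  show "0 \<le> ulc_coeff \<mu> n" for n by (rule ulc_coeff_nonneg)
  show "0 < ulc_coeff \<mu> m" if "m \<le> n" "0 < ulc_coeff \<mu> n" for m n
    using that dc by (auto simp: ulc_coeff_pos_iff downward_closed_def)
  show "ulc_coeff \<mu> n * dir_op u (dir_op u (ulc_coeff \<mu>)) n \<le> (dir_op u (ulc_coeff \<mu>) n)\<^sup>2" for n u
    using quad[of n u] by (cases "n \<in> set_pmf \<mu>") (simp_all add: ulc_coeff_eq_0_iff[THEN iffD2])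
qed

text \<open>The constant coefficient of the x-th derivative is \<open>ulc_coeff \<mu> x\<close>,
  positive on the support. Hence the derivative is log-concave, and its expansion at the origin
  gives the quadratic condition.\<close>

lemma strongly_log_concave_imp_lorentzian:
  assumes dc: "downward_closed (set_pmf \<mu>)" and slc: "strongly_log_concave (gen_fun \<mu>)"
  shows "lorentzian (ulc_coeff \<mu>)"
proof (rule lorentzian_ulc_coeffI[OF dc])
  fix x u assume x: "x \<in> set_pmf \<mu>"
  let ?f = "mixed_partial x (gen_fun \<mu>)"
  have term_eq: "(\<lambda>n. ?f n * mpower \<theta> n) = exp_term \<theta> (ulc_coeff \<mu>) x" for \<theta>
    by (simp add: fun_eq_iff mixed_partial_eq exp_term_def ulc_coeff_def gen_fun_def add.commute)
  have "?f 0 \<noteq> 0"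
    using x
    by (simp add: mixed_partial_eq gen_fun_def set_pmf_iff)
  then have "?f \<noteq> (\<lambda>_. 0)" by metis
  moreover have "zero_or_log_concave ?f" using slc by (simp add: strongly_log_concave_def)
  ultimately have "\<forall>\<theta>\<in>pos_orthant. converges_at ?f \<theta>" "log_concave_on pos_orthant (mfps_value ?f)"
    by (auto simp: zero_or_log_concave_def)
  moreover have "mfps_value ?f = (\<lambda>\<theta>. exp_op \<theta> (ulc_coeff \<mu>) x)"
    by (simp add: fun_eq_iff mfps_value_def exp_op_def term_eq)
  ultimately show "ulc_coeff \<mu> x * dir_op u (dir_op u (ulc_coeff \<mu>)) x \<le> (dir_op u (ulc_coeff \<mu>) x)\<^sup>2"
    by (intro log_concave_imp_quadratic ulc_coeff_nonneg) (auto simp: converges_at_def term_eq)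
qed

text \<open>Tilting replaces the array by its \<open>exp_op \<theta>\<close>, again Lorentzian;
  spectral independence is its quadratic condition at \<open>x\<close>.\<close>

lemma lorentzian_imp_tilted_pinning:
  assumes c: "lorentzian (ulc_coeff \<mu>)" and x: "x \<in> set_pmf \<mu>" and \<theta>: "\<theta> \<in> pos_orthant"
  shows "tilted_pinning_spectrally_independent 1 \<theta> \<mu> x"
proof -
  have \<theta>0: "0 \<le> \<theta> $ i" for i using \<theta> by (simp add: pos_orthant_def less_imp_le)
  have summ: "exp_term \<theta>' (ulc_coeff \<mu>) y summable_on UNIV" if "\<And>i. 0 \<le> \<theta>' $ i" for \<theta>' y
    using lorentzian_exp_term(1)[OF c that] by (rule has_sum_imp_summable)
  have "lorentzian (exp_op \<theta> (ulc_coeff \<mu>))" by (rule lorentzian_exp_op[OF c \<theta>0])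
  then show ?thesis
    by (subst tilted_pinning_iff[OF x \<theta> summ summ]) (auto simp: lorentzian_iff_dir_op \<theta>0)
qed

text \<open>The tilt by \<open>s = 1 - t\<close> gives the quadratic condition for
  \<open>F s\<close>, which tends entrywise to the original array as s decreases to 0.\<close>

lemma tilted_pinning_imp_lorentzian:
  fixes \<mu> :: "(nat ^ 'd::finite) pmf"
  assumes dc: "downward_closed (set_pmf \<mu>)"
    and si: "\<And>x t::real. x \<in> set_pmf \<mu> \<Longrightarrow> 0 \<le> t \<Longrightarrow> t < 1 \<Longrightarrow>
      tilted_pinning_spectrally_independent 1 ((1 - t) *\<^sub>R 1) \<mu> x"
  shows "lorentzian (ulc_coeff \<mu>)"
proof (rule lorentzian_ulc_coeffI[OF dc])
  fix x u assume x: "x \<in> set_pmf \<mu>"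
  define a where "a = ulc_coeff \<mu>"
  have a0: "0 \<le> a n" for n by (simp add: a_def ulc_coeff_nonneg)
  \<comment> \<open>The case \<open>t = 0\<close> gives convergence at the all-ones vector for
    support points; for other points every term is 0.\<close>
  have one: "exp_term 1 a y summable_on UNIV" for y
  proof (cases "y \<in> set_pmf \<mu>")
    case True
    then have "pinning_weight \<mu> y summable_on UNIV"
      using si[of y 0] by (simp add: tilted_pinning_spectrally_independent_def pinning_defined_def)
    then have "(\<lambda>k. mfact y * pinning_weight \<mu> y k) summable_on UNIV" by (rule summable_on_cmult_right)
    then show ?thesis
      by (simp add: pinning_weight_eq a_def)
  next
    case False
    then have "exp_term 1 a y k = 0" for k
      using downward_closedD[OF dc, of y k] by (auto simp: exp_term_def a_def ulc_coeff_eq_0_iff)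
    then have "exp_term 1 a y = (\<lambda>_. 0)" by (rule ext)
    then show ?thesis by simp
  qed
  define F where "F s = exp_op (s *\<^sub>R 1) a" for s :: real
  have scaled: "exp_term (s *\<^sub>R 1) a y summable_on UNIV" if s: "0 < s" "s \<le> 1" for s y
  proof (rule summable_on_comparison_test[OF one[of y]])
    fix k
    show "0 \<le> exp_term (s *\<^sub>R 1) a y k" using s a0 by (intro exp_term_nonneg) auto
    have "mpower (s *\<^sub>R 1) k \<le> 1" unfolding mpower_def using s by (intro prod_le_1) (auto simp: power_le_one)
    moreover have "0 \<le> exp_term 1 a y k" using a0 by (intro exp_term_nonneg) auto
    ultimately show "exp_term (s *\<^sub>R 1) a y k \<le> exp_term 1 a y k"
      unfolding exp_term_eq_one[of "s *\<^sub>R 1"] by (simp add: mult_left_le)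
  qed
  have F: "((\<lambda>s. F s y) \<longlongrightarrow> a y) (at_right 0)" for y
  proof -
    obtain R where R: "(R \<longlongrightarrow> dir_op 1 (dir_op 1 a) y / 2) (at_right 0)"
      "\<And>s. 0 < s \<Longrightarrow> s < 1 \<Longrightarrow> exp_op (s *\<^sub>R 1) a y = a y + s * dir_op 1 a y + s\<^sup>2 * R s"
      using exp_op_taylor[of a 1 y, OF a0 _ one] by (auto simp del: scaleR_one)
    have "((\<lambda>s. a y + s * dir_op 1 a y + s\<^sup>2 * R s) \<longlongrightarrow>
        a y + 0 * dir_op 1 a y + 0\<^sup>2 * (dir_op 1 (dir_op 1 a) y / 2)) (at_right 0)"
      by (intro tendsto_intros R)
    then have "((\<lambda>s. a y + s * dir_op 1 a y + s\<^sup>2 * R s) \<longlongrightarrow> a y) (at_right 0)" by simp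
    then show ?thesis
      by (rule Lim_transform_eventually) (auto intro!: eventually_at_rightI[of 0 1] simp: F_def R(2))
  qed
  have lim: "((\<lambda>s. dir_op u (G s) y) \<longlongrightarrow> dir_op u g y) (at_right 0)"
    if "\<And>y. ((\<lambda>s. G s y) \<longlongrightarrow> g y) (at_right (0::real))" for G :: "real \<Rightarrow> nat ^ 'd \<Rightarrow> real" and g y
    unfolding dir_op_eq by (intro tendsto_intros that)
  have "F s x * dir_op u (dir_op u (F s)) x \<le> (dir_op u (F s) x)\<^sup>2" if s: "0 < s" "s < 1" for s
  proof -
    have "tilted_pinning_spectrally_independent 1 (s *\<^sub>R 1) \<mu> x"
      using si[OF x, of "1 - s"] s by simp
    moreover have "s *\<^sub>R 1 \<in> (pos_orthant :: (real ^ 'd) set)" using s by (simp add: pos_orthant_def)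
    ultimately show ?thesis
      using tilted_pinning_iff[OF x, of "s *\<^sub>R 1"] one scaled[of s] s by (simp add: F_def a_def)
  qed
  then have "a x * dir_op u (dir_op u a) x \<le> (dir_op u a x)\<^sup>2"
    by (intro tendsto_le[OF _ tendsto_power[OF lim[OF F]] tendsto_mult[OF F lim[OF lim[OF F]]]])
       (auto intro!: eventually_at_rightI[of 0 1])
  then show "ulc_coeff \<mu> x * dir_op u (dir_op u (ulc_coeff \<mu>)) x \<le> (dir_op u (ulc_coeff \<mu>) x)\<^sup>2"
    by (simp add: a_def)
qed

theorem theorem4p26:
  fixes \<mu> :: "(nat ^ 'd::finite) pmf"
  assumes "downward_closed (set_pmf \<mu>)"
  shows
    "(ULC \<mu> \<longleftrightarrow>
        (\<forall>x\<in>set_pmf \<mu>. \<forall>t::real. 0 \<le> t \<and> t < 1 \<longrightarrow>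
           tilted_pinning_spectrally_independent 1 ((1 - t) *\<^sub>R 1) \<mu> x)) \<and>
     (ULC \<mu> \<longleftrightarrow>
        (\<forall>x\<in>set_pmf \<mu>. \<forall>\<theta>\<in>pos_orthant. tilted_pinning_spectrally_independent 1 \<theta> \<mu> x)) \<and>
     (ULC \<mu> \<longleftrightarrow> strongly_log_concave (gen_fun \<mu>)) \<and>
     (ULC \<mu> \<longleftrightarrow> completely_log_concave (gen_fun \<mu>))"
proof -
  \<comment> \<open>Scalar tilts lie in the positive orthant, so the statement for all tilts
    contains the scalar one, and a single converse closes both equivalences.\<close>
  have pos: "(1 - t) *\<^sub>R 1 \<in> (pos_orthant :: (real ^ 'd) set)" if "t < 1" for t :: real
    using that by (simp add: pos_orthant_def)
  note ulc = ULC_iff_lorentzian[OF assms]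
  have "ULC \<mu> \<longleftrightarrow> (\<forall>x\<in>set_pmf \<mu>. \<forall>t::real. 0 \<le> t \<and> t < 1 \<longrightarrow>
      tilted_pinning_spectrally_independent 1 ((1 - t) *\<^sub>R 1) \<mu> x)"
    unfolding ulc using tilted_pinning_imp_lorentzian[OF assms] lorentzian_imp_tilted_pinning pos by blast
  moreover have "ULC \<mu> \<longleftrightarrow> (\<forall>x\<in>set_pmf \<mu>. \<forall>\<theta>\<in>pos_orthant. tilted_pinning_spectrally_independent 1 \<theta> \<mu> x)"
    unfolding ulc using tilted_pinning_imp_lorentzian[OF assms] lorentzian_imp_tilted_pinning pos by blast
  moreover have "ULC \<mu> \<longleftrightarrow> strongly_log_concave (gen_fun \<mu>)"
    unfolding ulc using strongly_log_concave_imp_lorentzian[OF assms]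
      lorentzian_imp_completely_log_concave completely_imp_strongly_log_concave by blast
  moreover have "ULC \<mu> \<longleftrightarrow> completely_log_concave (gen_fun \<mu>)"
    unfolding ulc using strongly_log_concave_imp_lorentzian[OF assms]
      lorentzian_imp_completely_log_concave completely_imp_strongly_log_concave by blast
  ultimately show ?thesis by blast
qed

end
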